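(* Consider the misspecified variational inequality described in the context, let the standing assumptions (i)–(vi) hold, and let $(x^*,\theta^*,\lambda^* )$ satisfy the KKT conditions. Define $D_X=\sup_{x\in X}\|x-x^*\|<\infty$ and $D_\Theta=\sup_{\theta\in\Theta}\|\theta-\theta^*\|<\infty$. Consider the algorithm ALM-Misspecified VI with constant penalty $\rho_k\equiv\rho>0$ and primal step-size $$\gamma_k\equiv\gamma\in\Bigl(0,\ \bigl(\rho C_1+\|\lambda^*\|C_2+2L_{F,x}+L_{F,\theta}+C_2D_\Lambda\bigr)^{-1}\Bigr)\qquad\text{for some } D_\Lambda>0 .$$ Assume that the learning error satisfies $$\sum_{k=0}^\infty\|\theta_k-\theta^*\|<\infty\qquad\text{and}\qquad\sum_{k=0}^\infty(k+1)^2\|\theta_k-\theta^*\|^2<\infty ,$$ and that $\rho_k=\rho=\dfrac{1}{L^\Phi_{\lambda\theta}}$ for all $k\ge0$. Then the dual sequence $\{\lambda_k\}$ is bounded.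
   Context: Notation: $\|\cdot\|$ is the Euclidean norm (and the induced norm for matrices); $[\cdot]_+$ is the componentwise positive part; $\Pi_C$ is Euclidean projection onto a closed convex set $C$; $\mathcal N_C$ is the normal cone of $C$. Problem. $X=\prod_{i=1}^N X_i\subseteq\mathbb R^n$ with each $X_i\subseteq\mathbb R^{n_i}$ nonempty, closed and convex; $\Theta\subseteq\mathbb R^m$; $F:\mathbb R^n\times\mathbb R^m\to\mathbb R^n$ and $H:\mathbb R^m\to\mathbb R^m$ are continuous; $f=[f_1,\dots,f_J]^\top$ with real-valued $f_j(x,\theta)$. The parameter $\theta^*\in\Theta$ solves the secondary variational inequality $H(\theta^* )^\top(\vartheta-\theta^* )\ge0$ for all $\vartheta\in\Theta$, and $x^*\in\mathcal X(\theta^* )=\{x\in X: f_j(x,\theta^* )\le0,\ j=1,\dots,J\}$ satisfies $F(x^*,\theta^* )^\top(y-x^* )\ge0$ for all $y\in\mathcal X(\theta^* )$; such a solution pair is supposed to exist. Standing assumptions. (i) For each $\theta\in\Theta$, $F(\cdot,\theta)$ is continuous and monotone on $X$. (ii) On $\Theta$, $H$ is Lipschitz continuous with constant $L_H$ and strongly monotone: $(H(\theta)-H(\vartheta))^\top(\theta-\vartheta)\ge\mu_H\|\theta-\vartheta\|^2$ for all $\theta,\vartheta\in\Theta$, with $\mu_H>0$. (iii) For each $j$ and $\theta\in\Theta$, $f_j(\cdot,\theta)$ is convex and continuously differentiable on $X$; there is $L_{\nabla f,x}\ge0$ with $\|\nabla_xf_j(x,\theta)-\nabla_xf_j(y,\theta)\|\le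 L_{\nabla f,x}\|x-y\|$ for all $x,y\in X$, $\theta\in\Theta$; and for all $\theta\in\Theta$, $x\in X$, $f_j(\cdot,\theta)$ and $f_j(x,\cdot)$ are Lipschitz continuous with constants $L_{f,x}\ge0$ and $L_{f,\theta}\ge0$ respectively. (iv) There are $L_{F,x},L_{F,\theta}\ge0$ with $\|F(x_1,\theta)-F(x_2,\theta)\|\le L_{F,x}\|x_1-x_2\|$ for all $x_1,x_2\in X$, $\theta\in\Theta$, and $\|F(x,\theta_1)-F(x,\theta_2)\|\le L_{F,\theta}\|\theta_1-\theta_2\|$ for all $x\in X$, $\theta_1,\theta_2\in\Theta$. (v) $X$ and $\Theta$ are nonempty, closed, convex and compact. (vi) (Slater) There is $\hat x\in X$ with $f_j(\hat x,\theta^* )<0$ for all $j$. KKT conditions for $(x^*,\theta^*,\lambda^* )$ with $\lambda^*\in\mathbb R^J$: $0\in F(x^*,\theta^* )+\nabla_x f(x^*,\theta^* )^\top\lambda^*+\mathcal N_X(x^* )$; $0\in H(\theta^* )+\mathcal N_\Theta(\theta^* )$; $0\le\lambda^*\perp -f(x^*,\theta^* )\ge0$; $x^*\in\mathcal X(\theta^* )$ and $\theta^*\in\Theta$. Here $\nabla_x f(x,\theta)\in\mathbb R^{J\times n}$ is the Jacobian of $f(\cdot,\theta)$, with rows $\nabla_xf_j(x,\theta)^\top$. Augmented term. For $\rho>0$, $\Phi_\rho(x,\lambda,\theta)=\sum_{j=1}^J\phi_\rho(f_j(x,\theta),\lambda^{(j)})$, where $\phi_\rho(u,v)=uv+\frac\rho2u^2$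 if $\rho u+v\ge0$ and $\phi_\rho(u,v)=-\frac{v^2}{2\rho}$ otherwise. Algorithm (ALM-Misspecified VI). Given $x_0\in X$, $\theta_0\in\Theta$ and positive sequences $\{\rho_k\},\{\gamma_k\},\{\eta_k\}$, set $x_{-1}=x_0$, $\theta_{-1}=\theta_0$, $\lambda_0=\mathbf 0\in\mathbb R^J$, and for $k=0,1,2,\dots$: $r_k=F(x_k,\theta_k)-F(x_{k-1},\theta_{k-1})$; $x_{k+1}=\Pi_X\bigl[x_k-\gamma_k\bigl(F(x_k,\theta_k)+r_k+\nabla_xf(x_k,\theta_k)^\top[\rho_kf(x_k,\theta_k)+\lambda_k]_+\bigr)\bigr]$; $\lambda_{k+1}=[\lambda_k+\rho_kf(x_{k+1},\theta_k)]_+$; $\theta_{k+1}=\Pi_\Theta[\theta_k-\eta_kH(\theta_k)]$. Constants. $C_1=\sqrt J\,(L_{\nabla f,x}D_f+L_{f,x}M_{\nabla f})$ and $C_2=\sqrt J\,L_{\nabla f,x}$, where $D_f=\sup_{(z,\vartheta)\in X\times\Theta}\|[f(z,\vartheta)]_+\|<\infty$ and $M_{\nabla f}=\sup_{(z,\vartheta)\in X\times\Theta}\|\nabla_xf(z,\vartheta)\|<\infty$. $L^\Phi_{\lambda\theta}$ (positive) denotes the Lipschitz constant of $\nabla_\lambda\Phi_\rho(x,\lambda,\theta)$ with respect to $\theta$.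
   Formalization: "For some D_Λ > 0" is read as: there is a D_Λ > 0, depending on the problem data, ρ and the learning sequence but not on γ or the primal-dual run, such that all γ in the interval give bounded {λ_k}; with an arbitrary D_Λ > 0 the claim is false. *)

theory Defs
  imports "HOL-Analysis.Analysis"
begin

text \<open>
  The decomposition of \<open>\<real>\<^sup>n\<close> into \<open>N\<close> blocks is given by a map \<open>b\<close> sending every coordinate to its
  block. The factor \<open>\<real>\<^bsup>n_i\<^esup>\<close> is represented as the subspace of the vectors supported on
  block \<open>i\<close>, so that factors of different dimensions can share one type.
\<close>

definition block_part :: "('n::finite \<Rightarrow> 'i) \<Rightarrow> 'i \<Rightarrow> real^'n \<Rightarrow> real^'n" where
  "block_part b i x = (\<chi> k. if b k = i then x $ k else 0)"

definition block_product :: "('n::finite \<Rightarrow> 'i) \<Rightarrow> ('i \<Rightarrow> (real^'n) set) \<Rightarrow> (real^'n) set" where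
  "block_product b Xs = {x. \<forall>i. block_part b i x \<in> Xs i}"

definition pos_part :: "real^'j \<Rightarrow> real^'j" where
  "pos_part v = (\<chi> j. max 0 (v $ j))"

definition normal_cone :: "(real^'n) set \<Rightarrow> real^'n \<Rightarrow> (real^'n) set" where
  "normal_cone C x = (if x \<in> C then {v. \<forall>y\<in>C. v \<bullet> (y - x) \<le> 0} else {})"

definition monotone_map_on :: "(real^'n) set \<Rightarrow> (real^'n \<Rightarrow> real^'n) \<Rightarrow> bool" where
  "monotone_map_on C G \<longleftrightarrow> (\<forall>x\<in>C. \<forall>y\<in>C. (G x - G y) \<bullet> (x - y) \<ge> 0)"

definition strongly_monotone_map_on :: "real \<Rightarrow> (real^'n) set \<Rightarrow> (real^'n \<Rightarrow> real^'n) \<Rightarrow> bool" where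
  "strongly_monotone_map_on \<mu> C G \<longleftrightarrow>
     \<mu> > 0 \<and> (\<forall>x\<in>C. \<forall>y\<in>C. (G x - G y) \<bullet> (x - y) \<ge> \<mu> * (norm (x - y))\<^sup>2)"

definition solves_VI :: "(real^'n) set \<Rightarrow> (real^'n \<Rightarrow> real^'n) \<Rightarrow> real^'n \<Rightarrow> bool" where
  "solves_VI C G x \<longleftrightarrow> x \<in> C \<and> (\<forall>y\<in>C. G x \<bullet> (y - x) \<ge> 0)"

definition feasible_set ::
  "(real^'n) set \<Rightarrow> (real^'n \<Rightarrow> real^'m \<Rightarrow> real^'j) \<Rightarrow> real^'m \<Rightarrow> (real^'n) set" where
  "feasible_set X f \<theta> = {x\<in>X. \<forall>j. f x \<theta> $ j \<le> 0}"

text \<open>Meaningful only where \<open>g\<close> is differentiable.\<close>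

definition gradient :: "(real^'n \<Rightarrow> real) \<Rightarrow> real^'n \<Rightarrow> real^'n" where
  "gradient g x = (THE D. GDERIV g x :> D)"

text \<open>The rows of \<open>jacobian_x f x \<theta>\<close> are the gradients of the components of \<open>f\<close> in \<open>x\<close>.\<close>

definition jacobian_x :: "(real^'n \<Rightarrow> real^'m \<Rightarrow> real^'j) \<Rightarrow> real^'n \<Rightarrow> real^'m \<Rightarrow> real^'n^'j" where
  "jacobian_x f x \<theta> = jacobian (\<lambda>z. f z \<theta>) (at x)"

definition KKT ::
  "(real^'n) set \<Rightarrow> (real^'m) set \<Rightarrow> (real^'n \<Rightarrow> real^'m \<Rightarrow> real^'n) \<Rightarrow> (real^'m \<Rightarrow> real^'m) \<Rightarrow>
   (real^'n \<Rightarrow> real^'m \<Rightarrow> real^'j) \<Rightarrow> real^'n \<Rightarrow> real^'m \<Rightarrow> real^'j \<Rightarrow> bool" where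
  "KKT X \<Theta> F H f x \<theta> l \<longleftrightarrow>
     0 \<in> (+) (F x \<theta> + transpose (jacobian_x f x \<theta>) *v l) ` normal_cone X x \<and>
     0 \<in> (+) (H \<theta>) ` normal_cone \<Theta> \<theta> \<and>
     0 \<le> l \<and> orthogonal l (- f x \<theta>) \<and> 0 \<le> - f x \<theta> \<and>
     x \<in> feasible_set X f \<theta> \<and> \<theta> \<in> \<Theta>"

definition aug_term :: "real \<Rightarrow> real \<Rightarrow> real \<Rightarrow> real" where
  "aug_term \<rho> u v = (if \<rho> * u + v \<ge> 0 then u * v + \<rho> / 2 * u\<^sup>2 else - (v\<^sup>2 / (2 * \<rho>)))"

definition Phi ::
  "(real^'n \<Rightarrow> real^'m \<Rightarrow> real^'j) \<Rightarrow> real \<Rightarrow> real^'n \<Rightarrow> real^'j \<Rightarrow> real^'m \<Rightarrow> real" where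
  "Phi f \<rho> x l \<theta> = (\<Sum>j\<in>UNIV. aug_term \<rho> (f x \<theta> $ j) (l $ j))"

text \<open>
  The convention that the iterates of index \<open>-1\<close> equal those of index \<open>0\<close> is rendered by truncated
  subtraction: \<open>r\<close> vanishes at \<open>k = 0\<close>. Since \<open>X\<close> and \<open>\<Theta>\<close> are nonempty, closed and convex wherever
  this is used, \<^const>\<open>closest_point\<close> is the Euclidean projection.
\<close>

definition ALM_iterates ::
  "(real^'n) set \<Rightarrow> (real^'m) set \<Rightarrow> (real^'n \<Rightarrow> real^'m \<Rightarrow> real^'n) \<Rightarrow> (real^'m \<Rightarrow> real^'m) \<Rightarrow>
   (real^'n \<Rightarrow> real^'m \<Rightarrow> real^'j) \<Rightarrow> (nat \<Rightarrow> real) \<Rightarrow> (nat \<Rightarrow> real) \<Rightarrow> (nat \<Rightarrow> real) \<Rightarrow>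
   (nat \<Rightarrow> real^'n) \<Rightarrow> (nat \<Rightarrow> real^'m) \<Rightarrow> (nat \<Rightarrow> real^'j) \<Rightarrow> bool" where
  "ALM_iterates X \<Theta> F H f \<rho> \<gamma> \<eta> x \<theta> l \<longleftrightarrow>
     x 0 \<in> X \<and> \<theta> 0 \<in> \<Theta> \<and> l 0 = 0 \<and>
     (\<forall>k. let r = F (x k) (\<theta> k) - F (x (k - 1)) (\<theta> (k - 1)) in
        x (Suc k) = closest_point X (x k - \<gamma> k *\<^sub>R (F (x k) (\<theta> k) + r
            + transpose (jacobian_x f (x k) (\<theta> k)) *v pos_part (\<rho> k *\<^sub>R f (x k) (\<theta> k) + l k))) \<and>
        l (Suc k) = pos_part (l k + \<rho> k *\<^sub>R f (x (Suc k)) (\<theta> k)) \<and>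
        \<theta> (Suc k) = closest_point \<Theta> (\<theta> k - \<eta> k *\<^sub>R H (\<theta> k)))"

definition constraint_bound ::
  "(real^'n) set \<Rightarrow> (real^'m) set \<Rightarrow> (real^'n \<Rightarrow> real^'m \<Rightarrow> real^'j) \<Rightarrow> real" where
  "constraint_bound X \<Theta> f = (SUP (z, \<theta>)\<in>X \<times> \<Theta>. norm (pos_part (f z \<theta>)))"

text \<open>
  The norm of a matrix is the operator norm induced by the Euclidean norms; \<^const>\<open>norm\<close> on
  \<open>real^'n^'j\<close> would be the Frobenius norm.
\<close>

definition jacobian_bound ::
  "(real^'n) set \<Rightarrow> (real^'m) set \<Rightarrow> (real^'n \<Rightarrow> real^'m \<Rightarrow> real^'j) \<Rightarrow> real" where
  "jacobian_bound X \<Theta> f = (SUP (z, \<theta>)\<in>X \<times> \<Theta>. onorm ((*v) (jacobian_x f z \<theta>)))"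

end

theory Submission
  imports Defs
begin

text \<open>
  The proof follows the energy
  \<open>\<parallel>x\<^sub>k - x\<^sup>*\<parallel>\<^sup>2 / (2\<gamma>) + \<parallel>\<lambda>\<^sub>k - \<lambda>\<^sup>*\<parallel>\<^sup>2 / (2\<rho>) + (L / 2) \<parallel>x\<^sub>k - x\<^sub>k\<^sub>-\<^sub>1\<parallel>\<^sup>2 - \<langle>r\<^sub>k, x\<^sub>k - x\<^sup>*\<rangle>\<close> with
  \<open>L\<close> the Lipschitz constant of \<open>F\<close> in \<open>x\<close>.
  Under the step size condition it would be nonincreasing if the parameter were known, and otherwise it
  grows per step by at most a constant times the parameter errors around index \<open>k\<close>
  (\<open>energy_step\<close>). Three facts make it work.

  The multiplier update fits the augmented term exactly: since
  \<open>\<phi>\<^sub>\<rho>(u,v) = ((max 0 (v + \<rho>u))\<^sup>2 - v\<^sup>2) / (2\<rho>)\<close>, the change of \<open>\<parallel>\<lambda> - \<lambda>\<^sup>*\<parallel>\<^sup>2 / (2\<rho>)\<close> is at most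
  \<open>\<Phi>\<^sub>\<rho> - \<langle>\<lambda>\<^sup>*, f\<rangle>\<close> at the new primal point (\<open>Phi_multiplier_step\<close>).

  The primal update linearises \<open>\<Phi>\<^sub>\<rho>\<close> at the old point. In \<open>x\<close> this function is convex and lies below a
  parabola of curvature \<open>\<rho>C\<^sub>1 + C\<^sub>2\<parallel>\<lambda>\<^sub>k\<parallel>\<close> (\<open>Phi_above_tangent\<close>, \<open>Phi_below_parabola\<close>), so the
  linearisation error is absorbed by the proximal term \<open>\<parallel>x\<^sub>k\<^sub>+\<^sub>1 - x\<^sub>k\<parallel>\<^sup>2 / (2\<gamma>)\<close>. The correction
  \<open>r\<^sub>k\<close> turns \<open>F\<close> at the old point into \<open>F\<close> at the new one up to a telescoping term; there monotonicity
  and the KKT conditions apply (\<open>F_at_iterate_lower_bound\<close>, \<open>KKT_variational_inequality\<close>).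

  The curvature depends on the multiplier that is to be bounded, and so does the energy growth. The
  circle is broken by induction: as long as \<open>\<parallel>\<lambda>\<^sub>i - \<lambda>\<^sup>*\<parallel> \<le> D\<close> for the earlier indices and the step size
  is compatible with \<open>D\<close>, summing the energy inequality gives a bound of the form
  \<open>\<parallel>\<lambda>\<^sub>k - \<lambda>\<^sup>*\<parallel>\<^sup>2 \<le> E\<^sub>0 + E\<^sub>1 D + \<rho> diam(X)\<^sup>2 / \<gamma>\<close>, because the parameter errors are summable
  (\<open>multiplier_distance_le\<close>). The right-hand side grows linearly in \<open>D\<close>, hence is at most \<open>D\<^sup>2\<close> for large
  \<open>D\<close>. The term \<open>1/\<gamma>\<close> is harmless even though \<open>\<gamma>\<close> may be arbitrarily small and is chosen after
  \<open>D\<^sub>\<Lambda>\<close>: a small \<open>\<gamma>\<close> allows a large radius, and with the largest radius compatible with \<open>\<gamma>\<close> the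
  number \<open>1/\<gamma>\<close> is itself an affine function of that radius (\<open>exists_radius\<close>).
\<close>

section \<open>The scalar augmented term\<close>

text \<open>
  Both branches of the definition become one once the square is completed. The formula exhibits
  \<open>max 0 (v + \<rho>u)\<close>, which is at once the updated multiplier and the derivative in \<open>u\<close>.
\<close>

lemma aug_term_eq:
  assumes "\<rho> > 0"
  shows "aug_term \<rho> u v = ((max 0 (v + \<rho> * u))\<^sup>2 - v\<^sup>2) / (2 * \<rho>)"
  using assms by (auto simp: aug_term_def max_def field_simps power2_eq_square)

text \<open>
  Expanding the squares leaves \<open>-2w\<close> times the change of the multiplier, and the positive part can only
  make this change larger than \<open>\<rho>u\<close>; the sign of \<open>w\<close> turns that into the claim.
\<close>

lemma aug_term_dual_step:
  assumes "\<rho> > 0" "w \<ge> 0"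
  shows "((max 0 (v + \<rho> * u) - w)\<^sup>2 - (v - w)\<^sup>2) / (2 * \<rho>) \<le> aug_term \<rho> u v - w * u"
proof -
  have "w * (v + \<rho> * u) \<le> w * max 0 (v + \<rho> * u)"
    using assms by (intro mult_left_mono) auto
  then have "(max 0 (v + \<rho> * u) - w)\<^sup>2 - (v - w)\<^sup>2
      \<le> ((max 0 (v + \<rho> * u))\<^sup>2 - v\<^sup>2) - 2 * \<rho> * (w * u)"
    by (simp add: power2_eq_square algebra_simps)
  then have "((max 0 (v + \<rho> * u) - w)\<^sup>2 - (v - w)\<^sup>2) / (2 * \<rho>)
      \<le> (((max 0 (v + \<rho> * u))\<^sup>2 - v\<^sup>2) - 2 * \<rho> * (w * u)) / (2 * \<rho>)"
    using assms by (intro divide_right_mono) auto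
  then show ?thesis
    using assms by (simp add: aug_term_eq diff_divide_distrib)
qed

text \<open>
  Convexity and, below, smoothness of the augmented term in \<open>u\<close>: its derivative
  \<open>max 0 (v + \<rho>u)\<close> is nondecreasing and has slope at most \<open>\<rho>\<close>.
\<close>

lemma aug_term_above_tangent:
  assumes "\<rho> > 0"
  shows "aug_term \<rho> u v + max 0 (v + \<rho> * u) * (u' - u) \<le> aug_term \<rho> u' v"
proof -
  have *: "(max 0 s)\<^sup>2 + 2 * max 0 s * (s' - s) \<le> (max 0 s')\<^sup>2" for s s' :: real
  proof -
    have "0 \<le> (max 0 s - max 0 s')\<^sup>2" "max 0 s * (s' - s) \<le> max 0 s * (max 0 s' - max 0 s)"
      by (auto simp: max_def mult_left_mono)
    then show ?thesis by (simp add: power2_eq_square algebra_simps)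
  qed
  have "((max 0 (v + \<rho> * u))\<^sup>2 - v\<^sup>2) + 2 * \<rho> * (max 0 (v + \<rho> * u) * (u' - u))
      \<le> (max 0 (v + \<rho> * u'))\<^sup>2 - v\<^sup>2"
    using *[of "v + \<rho> * u" "v + \<rho> * u'"] by (simp add: algebra_simps)
  then have "(((max 0 (v + \<rho> * u))\<^sup>2 - v\<^sup>2) + 2 * \<rho> * (max 0 (v + \<rho> * u) * (u' - u))) / (2 * \<rho>)
      \<le> ((max 0 (v + \<rho> * u'))\<^sup>2 - v\<^sup>2) / (2 * \<rho>)"
    using assms by (intro divide_right_mono) auto
  then show ?thesis
    using assms by (simp add: aug_term_eq add_divide_distrib)
qed

lemma aug_term_below_parabola:
  assumes "\<rho> > 0"
  shows "aug_term \<rho> u' v \<le> aug_term \<rho> u v + max 0 (v + \<rho> * u) * (u' - u) + \<rho> / 2 * (u' - u)\<^sup>2"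
proof -
  have *: "(max 0 s')\<^sup>2 \<le> (max 0 s)\<^sup>2 + 2 * max 0 s * (s' - s) + (s' - s)\<^sup>2" for s s' :: real
  proof (cases "s \<ge> 0")
    case True
    then have "(max 0 s)\<^sup>2 + 2 * max 0 s * (s' - s) + (s' - s)\<^sup>2 = s'\<^sup>2"
      by (simp add: power2_eq_square algebra_simps)
    then show ?thesis by (auto simp: max_def)
  next
    case False
    then show ?thesis by (auto simp: max_def intro!: power_mono)
  qed
  have "(max 0 (v + \<rho> * u'))\<^sup>2 - v\<^sup>2 \<le> ((max 0 (v + \<rho> * u))\<^sup>2 - v\<^sup>2)
      + 2 * \<rho> * (max 0 (v + \<rho> * u) * (u' - u)) + \<rho>\<^sup>2 * (u' - u)\<^sup>2"
    using *[of "v + \<rho> * u'" "v + \<rho> * u"] by (simp add: power2_eq_square algebra_simps)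
  then have "((max 0 (v + \<rho> * u'))\<^sup>2 - v\<^sup>2) / (2 * \<rho>) \<le> (((max 0 (v + \<rho> * u))\<^sup>2 - v\<^sup>2)
      + 2 * \<rho> * (max 0 (v + \<rho> * u) * (u' - u)) + \<rho>\<^sup>2 * (u' - u)\<^sup>2) / (2 * \<rho>)"
    using assms by (intro divide_right_mono) auto
  also have "\<dots> = ((max 0 (v + \<rho> * u))\<^sup>2 - v\<^sup>2) / (2 * \<rho>)
      + max 0 (v + \<rho> * u) * (u' - u) + \<rho> / 2 * (u' - u)\<^sup>2"
    using assms by (simp add: add_divide_distrib power2_eq_square)
  finally show ?thesis
    using assms by (simp add: aug_term_eq)
qed

text \<open>
  The augmented term increases with \<open>u\<close>. For \<open>d = 0\<close> this says that it is nonpositive at a feasible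
  point; a positive \<open>d\<close> measures how far feasibility fails under a wrong parameter.
\<close>

lemma aug_term_le:
  assumes "\<rho> > 0" "v \<ge> 0" "u \<le> d" "d \<ge> 0"
  shows "aug_term \<rho> u v \<le> d * v + \<rho> / 2 * d\<^sup>2"
proof -
  have "(max 0 (v + \<rho> * u))\<^sup>2 \<le> (v + \<rho> * d)\<^sup>2"
    using assms by (intro power_mono) (auto simp: mult_left_mono)
  then have "aug_term \<rho> u v \<le> ((v + \<rho> * d)\<^sup>2 - v\<^sup>2) / (2 * \<rho>)"
    using assms by (simp add: aug_term_eq divide_right_mono)
  also have "\<dots> = d * v + \<rho> / 2 * d\<^sup>2"
    using assms by (simp add: field_simps power2_eq_square)
  finally show ?thesis .
qed

section \<open>Gradients and Jacobians on a convex set\<close>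

lemma has_derivative_gradient:
  fixes g :: "real^'n \<Rightarrow> real"
  assumes "g differentiable (at x)"
  shows "(g has_derivative (\<lambda>h. gradient g x \<bullet> h)) (at x)"
proof -
  obtain g' where g': "(g has_derivative g') (at x)"
    using assms by (auto simp: differentiable_def)
  then have "bounded_linear g'" by (rule has_derivative_bounded_linear)
  define D where "D = (\<chi> i. g' (axis i 1))"
  have "g' h = D \<bullet> h" for h
  proof -
    have "g' h = g' (\<Sum>i\<in>UNIV. h $ i *\<^sub>R axis i 1)"
      by (simp add: basis_expansion scalar_mult_eq_scaleR[symmetric])
    also have "\<dots> = D \<bullet> h"
      using \<open>bounded_linear g'\<close>
      by (simp add: bounded_linear.linear linear_sum linear_scale D_def inner_vec_def mult.commute)
    finally show ?thesis .
  qed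
  then have "g' = (\<lambda>h. h \<bullet> D)"
    by (simp add: fun_eq_iff inner_commute)
  then have "GDERIV g x :> D"
    using g' by (simp add: gderiv_def)
  then have "GDERIV g x :> gradient g x"
    unfolding gradient_def
  proof (rule theI)
    fix E assume "GDERIV g x :> E"
    then have "(\<lambda>h. h \<bullet> E) = (\<lambda>h. h \<bullet> D)"
      using has_derivative_unique \<open>GDERIV g x :> D\<close> unfolding gderiv_def by blast
    then have "(E - D) \<bullet> (E - D) = 0"
      by (metis inner_diff_right right_minus_eq)
    then show "E = D" by simp
  qed
  then show ?thesis
    unfolding gderiv_def by (simp add: inner_commute)
qed

lemma gradient_along_segment:
  fixes g :: "real^'n \<Rightarrow> real"
  assumes "g differentiable (at (x + t *\<^sub>R d))"
  shows "((\<lambda>t. g (x + t *\<^sub>R d)) has_real_derivative gradient g (x + t *\<^sub>R d) \<bullet> d) (at t)"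
proof -
  have "((\<lambda>t. x + t *\<^sub>R d) has_derivative (\<lambda>s. s *\<^sub>R d)) (at t)"
    by (auto intro!: derivative_eq_intros)
  then have "((\<lambda>t. g (x + t *\<^sub>R d)) has_derivative (\<lambda>s. gradient g (x + t *\<^sub>R d) \<bullet> (s *\<^sub>R d))) (at t)"
    using has_derivative_compose has_derivative_gradient[OF assms] by fastforce
  then show ?thesis
    by (simp add: has_field_derivative_def mult.commute[of _ "gradient g _ \<bullet> d"] mult_commute_abs)
qed

text \<open>
  The point \<open>x\<close> may lie on the boundary of \<open>S\<close>, so the difference quotients along the segment towards
  \<open>y\<close> are compared with their one-sided limit.
\<close>

lemma convex_on_above_gradient:
  fixes g :: "real^'n \<Rightarrow> real"
  assumes "convex_on S g" "x \<in> S" "y \<in> S" "g differentiable (at x)"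
  shows "g x + gradient g x \<bullet> (y - x) \<le> g y"
proof -
  let ?h = "\<lambda>t. g (x + t *\<^sub>R (y - x))"
  have "(?h has_real_derivative gradient g x \<bullet> (y - x)) (at 0)"
    using gradient_along_segment[of g x 0 "y - x"] assms(4) by simp
  then have "((\<lambda>t. (?h t - ?h 0) / (t - 0)) \<longlongrightarrow> gradient g x \<bullet> (y - x)) (at 0 within {0<..})"
    unfolding has_field_derivative_iff by (auto intro: tendsto_mono[OF at_le])
  moreover have "\<forall>\<^sub>F t in at_right (0::real). (?h t - ?h 0) / (t - 0) \<le> g y - g x"
  proof -
    have "(?h t - ?h 0) / (t - 0) \<le> g y - g x" if "0 < t" "t < 1" for t
    proof -
      have "g ((1 - t) *\<^sub>R x + t *\<^sub>R y) \<le> (1 - t) * g x + t * g y"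
        using that assms(1-3) by (intro convex_onD) auto
      moreover have "(1 - t) *\<^sub>R x + t *\<^sub>R y = x + t *\<^sub>R (y - x)"
        by (simp add: algebra_simps)
      ultimately show ?thesis using that by (simp add: field_simps)
    qed
    then show ?thesis
      using eventually_at_right_real[of 0 "1::real"] by (auto elim!: eventually_mono)
  qed
  ultimately have "gradient g x \<bullet> (y - x) \<le> g y - g x"
    by (intro tendsto_upperbound) auto
  then show ?thesis by simp
qed

text \<open>
  The sharp factor \<open>1/2\<close> matters, since the whole proximal term is needed to absorb this error together
  with that of the correction \<open>r\<^sub>k\<close>; convexity alone would lose a factor \<open>2\<close>. On the segment from \<open>x\<close>
  to \<open>y\<close> the difference of both sides is monotone, as its derivative has a sign.
\<close>

lemma Lipschitz_gradient_descent:
  fixes g :: "real^'n \<Rightarrow> real"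
  assumes "convex S" "x \<in> S" "y \<in> S"
    and diff: "\<And>z. z \<in> S \<Longrightarrow> g differentiable (at z)"
    and lip: "L-lipschitz_on S (gradient g)"
  shows "g y \<le> g x + gradient g x \<bullet> (y - x) + L / 2 * (norm (y - x))\<^sup>2"
proof -
  let ?d = "y - x"
  let ?h = "\<lambda>t. g (x + t *\<^sub>R ?d) - t * (gradient g x \<bullet> ?d) - L / 2 * t\<^sup>2 * (norm ?d)\<^sup>2"
  let ?h' = "\<lambda>t. gradient g (x + t *\<^sub>R ?d) \<bullet> ?d - gradient g x \<bullet> ?d - L * t * (norm ?d)\<^sup>2"
  have in_S: "x + t *\<^sub>R ?d \<in> S" if "0 \<le> t" "t \<le> 1" for t
  proof -
    have "(1 - t) *\<^sub>R x + t *\<^sub>R y \<in> S" using assms(1-3) that by (simp add: convexD_alt)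
    then show ?thesis by (simp add: algebra_simps)
  qed
  have "?h 1 \<le> ?h 0"
  proof (rule DERIV_nonpos_imp_nonincreasing[of 0 1 ?h])
    fix t :: real assume t: "0 \<le> t" "t \<le> 1"
    have "(?h has_real_derivative ?h' t) (at t)"
      by (rule derivative_eq_intros gradient_along_segment[OF diff[OF in_S[OF t]]] refl)+
        (simp add: algebra_simps)
    moreover have "?h' t \<le> 0"
    proof -
      have "gradient g (x + t *\<^sub>R ?d) \<bullet> ?d - gradient g x \<bullet> ?d
          \<le> norm (gradient g (x + t *\<^sub>R ?d) - gradient g x) * norm ?d"
        by (metis inner_diff_left norm_cauchy_schwarz)
      also have "\<dots> \<le> (L * norm (t *\<^sub>R ?d)) * norm ?d"
        using lipschitz_onD[OF lip in_S[OF t] assms(2)]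
        by (intro mult_right_mono) (auto simp: dist_norm)
      also have "\<dots> = L * t * (norm ?d)\<^sup>2" using t by (simp add: power2_eq_square)
      finally show ?thesis by simp
    qed
    ultimately show "\<exists>D. (?h has_real_derivative D) (at t) \<and> D \<le> 0" by blast
  qed simp
  then show ?thesis by simp
qed

lemma differentiable_vec_componentwise:
  fixes g :: "real^'n \<Rightarrow> real^'j"
  assumes "\<And>j. (\<lambda>z. g z $ j) differentiable (at x)"
  shows "g differentiable (at x)"
  using assms
  by (subst differentiable_componentwise_within) (auto simp: Basis_vec_def inner_axis)

lemma jacobian_nth_gradient:
  fixes g :: "real^'n \<Rightarrow> real^'j"
  assumes "\<And>j. (\<lambda>z. g z $ j) differentiable (at x)"
  shows "(jacobian g (at x) *v d) $ j = gradient (\<lambda>z. g z $ j) x \<bullet> d"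
proof -
  have "(g has_derivative (\<lambda>h. jacobian g (at x) *v h)) (at x)"
    using differentiable_vec_componentwise[OF assms] by (rule iffD1[OF jacobian_works])
  then have "((\<lambda>z. g z $ j) has_derivative (\<lambda>h. (jacobian g (at x) *v h) $ j)) (at x)"
    by (rule bounded_linear.has_derivative[OF bounded_linear_vec_nth])
  then show ?thesis
    using has_derivative_unique[OF _ has_derivative_gradient[OF assms[of j]]] by metis
qed

text \<open>
  The weighted Jacobian term of the algorithm is the gradient of a weighted sum of the constraint
  functions, which reduces the vector estimates to scalar ones.
\<close>

lemma transpose_jacobian_inner:
  fixes g :: "real^'n \<Rightarrow> real^'j"
  assumes "\<And>j. (\<lambda>z. g z $ j) differentiable (at x)"
  shows "(transpose (jacobian g (at x)) *v w) \<bullet> d = (\<Sum>j\<in>UNIV. w $ j * (gradient (\<lambda>z. g z $ j) x \<bullet> d))"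
  unfolding vector_transpose_matrix[symmetric]
  by (simp add: dot_lmul_matrix) (simp add: inner_vec_def jacobian_nth_gradient[OF assms, unfolded inner_vec_def])

section \<open>Norm estimates and the projection step\<close>

lemma sum_abs_le_sqrt_card_norm:
  fixes w :: "real^'j"
  shows "(\<Sum>j\<in>UNIV. \<bar>w $ j\<bar>) \<le> sqrt (real CARD('j)) * norm w"
proof -
  have "(\<Sum>j\<in>UNIV. \<bar>w $ j\<bar> * 1) \<le> L2_set (\<lambda>j. \<bar>w $ j\<bar>) UNIV * L2_set (\<lambda>_. 1) (UNIV :: 'j set)"
    using L2_set_mult_ineq[of "\<lambda>j. w $ j" "\<lambda>_. 1" "UNIV :: 'j set"] by (simp add: L2_set_def)
  then show ?thesis by (simp add: L2_set_def norm_vec_def mult.commute)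
qed

lemma norm_le_sqrt_card:
  fixes w :: "real^'j"
  assumes "\<And>j. \<bar>w $ j\<bar> \<le> c" "c \<ge> 0"
  shows "norm w \<le> sqrt (real CARD('j)) * c"
proof -
  have "L2_set (\<lambda>j. norm (w $ j)) UNIV \<le> L2_set (\<lambda>_. c) (UNIV :: 'j set)"
    using assms by (intro L2_set_mono) auto
  then show ?thesis using assms by (simp add: norm_vec_def L2_set_def real_sqrt_mult)
qed

lemma norm_power2_vec: "(norm (w :: real^'j))\<^sup>2 = (\<Sum>j\<in>UNIV. (w $ j)\<^sup>2)"
  by (simp only: power2_norm_eq_inner) (simp add: inner_vec_def power2_eq_square)

lemma norm_le_componentwise:
  fixes v w :: "real^'j"
  assumes "\<And>j. \<bar>v $ j\<bar> \<le> \<bar>w $ j\<bar>"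
  shows "norm v \<le> norm w"
  unfolding norm_vec_def using assms by (intro L2_set_mono) auto

lemma pos_part_nth [simp]: "pos_part v $ j = max 0 (v $ j)"
  by (simp add: pos_part_def)

text \<open>
  This is where the bound on \<open>[f]\<^sub>+\<close>, rather than one on \<open>f\<close>, suffices: only the positive part of \<open>f\<close>
  can raise the positive part of \<open>\<rho>f + \<lambda>\<close> above \<open>\<lambda>\<close>.
\<close>

lemma norm_pos_part_shift_le:
  fixes u l :: "real^'j"
  assumes "0 \<le> l" "\<rho> \<ge> 0"
  shows "norm (pos_part (\<rho> *\<^sub>R u + l)) \<le> \<rho> * norm (pos_part u) + norm l"
proof -
  have "norm (pos_part (\<rho> *\<^sub>R u + l)) \<le> norm (\<rho> *\<^sub>R pos_part u + l)"
  proof (rule norm_le_componentwise)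
    fix j
    have "0 \<le> \<rho> * max 0 (u $ j)" "\<rho> * u $ j \<le> \<rho> * max 0 (u $ j)" "0 \<le> l $ j"
      using assms by (auto intro!: mult_left_mono simp: less_eq_vec_def)
    then show "\<bar>pos_part (\<rho> *\<^sub>R u + l) $ j\<bar> \<le> \<bar>(\<rho> *\<^sub>R pos_part u + l) $ j\<bar>"
      by simp
  qed
  also have "\<dots> \<le> \<rho> * norm (pos_part u) + norm l"
    using norm_triangle_ineq[of "\<rho> *\<^sub>R pos_part u" l] assms(2) by simp
  finally show ?thesis .
qed

text \<open>
  The obtuse-angle characterisation of the projection, rewritten with the law of cosines.
\<close>

lemma projection_step:
  fixes C :: "(real^'n) set"
  assumes "convex C" "closed C" "y \<in> C" "\<gamma> > 0" and z: "z = closest_point C (x - \<gamma> *\<^sub>R g)"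
  shows "g \<bullet> (z - y) \<le> ((norm (x - y))\<^sup>2 - (norm (z - y))\<^sup>2 - (norm (z - x))\<^sup>2) / (2 * \<gamma>)"
proof -
  have "(x - \<gamma> *\<^sub>R g - z) \<bullet> (y - z) \<le> 0"
    using closest_point_dot[OF assms(1-3)] z by blast
  then have "2 * \<gamma> * (g \<bullet> (z - y)) \<le> (norm (x - y))\<^sup>2 - (norm (z - y))\<^sup>2 - (norm (z - x))\<^sup>2"
    by (simp add: power2_norm_eq_inner algebra_simps inner_commute)
  then show ?thesis using assms(4) by (simp add: field_simps)
qed

section \<open>Lagrangian estimates at a fixed parameter\<close>

locale misspecified_problem =
  fixes X :: "(real^'n) set"
    and \<Theta> :: "(real^'m) set"
    and F :: "real^'n \<Rightarrow> real^'m \<Rightarrow> real^'n"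
    and H :: "real^'m \<Rightarrow> real^'m"
    and f :: "real^'n \<Rightarrow> real^'m \<Rightarrow> real^'j"
    and xs :: "real^'n" and \<theta>s :: "real^'m" and ls :: "real^'j"
    and L\<^sub>d\<^sub>f L\<^sub>f\<^sub>x L\<^sub>f\<^sub>\<theta> L\<^sub>F\<^sub>x L\<^sub>F\<^sub>\<theta> :: real
  assumes convex_X: "convex X" and compact_X: "compact X" and compact_\<Theta>: "compact \<Theta>"
    and F_mono: "\<theta> \<in> \<Theta> \<Longrightarrow> monotone_map_on X (\<lambda>x. F x \<theta>)"
    and F_Lipschitz_x: "\<theta> \<in> \<Theta> \<Longrightarrow> L\<^sub>F\<^sub>x-lipschitz_on X (\<lambda>x. F x \<theta>)"
    and F_Lipschitz_\<theta>: "x \<in> X \<Longrightarrow> L\<^sub>F\<^sub>\<theta>-lipschitz_on \<Theta> (\<lambda>\<theta>. F x \<theta>)"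
    and f_convex: "\<theta> \<in> \<Theta> \<Longrightarrow> convex_on X (\<lambda>x. f x \<theta> $ j)"
    and f_diff: "\<theta> \<in> \<Theta> \<Longrightarrow> x \<in> X \<Longrightarrow> (\<lambda>z. f z \<theta> $ j) differentiable (at x)"
    and f_grad_Lipschitz: "\<theta> \<in> \<Theta> \<Longrightarrow> L\<^sub>d\<^sub>f-lipschitz_on X (gradient (\<lambda>z. f z \<theta> $ j))"
    and f_Lipschitz_x: "\<theta> \<in> \<Theta> \<Longrightarrow> L\<^sub>f\<^sub>x-lipschitz_on X (\<lambda>x. f x \<theta> $ j)"
    and f_Lipschitz_\<theta>: "x \<in> X \<Longrightarrow> L\<^sub>f\<^sub>\<theta>-lipschitz_on \<Theta> (\<lambda>\<theta>. f x \<theta> $ j)"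
    and KKT_point: "KKT X \<Theta> F H f xs \<theta>s ls"
    and D_finite: "bdd_above ((\<lambda>(z, \<theta>). norm (pos_part (f z \<theta>))) ` (X \<times> \<Theta>))"
    and M_finite: "bdd_above ((\<lambda>(z, \<theta>). onorm ((*v) (jacobian_x f z \<theta>))) ` (X \<times> \<Theta>))"
begin

definition "C\<^sub>1 = sqrt (real CARD('j)) *
  (L\<^sub>d\<^sub>f * constraint_bound X \<Theta> f + L\<^sub>f\<^sub>x * jacobian_bound X \<Theta> f)"

definition "C\<^sub>2 = sqrt (real CARD('j)) * L\<^sub>d\<^sub>f"

lemma xs_in: "xs \<in> X" and \<theta>s_in: "\<theta>s \<in> \<Theta>" and ls_nonneg: "0 \<le> ls $ j"
  and f_xs_le_0: "f xs \<theta>s $ j \<le> 0"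
  using KKT_point by (auto simp: KKT_def feasible_set_def less_eq_vec_def)

lemma Lipschitz_constants_nonneg: "0 \<le> L\<^sub>d\<^sub>f" "0 \<le> L\<^sub>f\<^sub>x" "0 \<le> L\<^sub>f\<^sub>\<theta>" "0 \<le> L\<^sub>F\<^sub>x" "0 \<le> L\<^sub>F\<^sub>\<theta>"
  using f_grad_Lipschitz[OF \<theta>s_in] f_Lipschitz_x[OF \<theta>s_in] f_Lipschitz_\<theta>[OF xs_in]
    F_Lipschitz_x[OF \<theta>s_in] F_Lipschitz_\<theta>[OF xs_in]
  by (auto dest: lipschitz_on_nonneg)

lemma C2_nonneg: "0 \<le> C\<^sub>2"
  using Lipschitz_constants_nonneg by (simp add: C\<^sub>2_def)

lemma norm_diff_le_diameter:
  "x \<in> X \<Longrightarrow> y \<in> X \<Longrightarrow> norm (x - y) \<le> diameter X"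
  "\<theta> \<in> \<Theta> \<Longrightarrow> \<theta>' \<in> \<Theta> \<Longrightarrow> norm (\<theta> - \<theta>') \<le> diameter \<Theta>"
  by (auto simp: dist_norm[symmetric]
      intro!: diameter_bounded_bound compact_imp_bounded compact_X compact_\<Theta>)

lemma diameter_nonneg: "0 \<le> diameter X" "0 \<le> diameter \<Theta>"
  using norm_diff_le_diameter(1)[OF xs_in xs_in] norm_diff_le_diameter(2)[OF \<theta>s_in \<theta>s_in] by auto

lemma norm_pos_part_f_le: "x \<in> X \<Longrightarrow> \<theta> \<in> \<Theta> \<Longrightarrow> norm (pos_part (f x \<theta>)) \<le> constraint_bound X \<Theta> f"
  unfolding constraint_bound_def using cSUP_upper[OF _ D_finite, of "(x, \<theta>)"] by simp

lemma onorm_jacobian_le: "x \<in> X \<Longrightarrow> \<theta> \<in> \<Theta> \<Longrightarrow> onorm ((*v) (jacobian_x f x \<theta>)) \<le> jacobian_bound X \<Theta> f"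
  unfolding jacobian_bound_def using cSUP_upper[OF _ M_finite, of "(x, \<theta>)"] by simp

text \<open>
  Of the two Lipschitz bounds for \<open>f\<close> in \<open>x\<close>, one comes from the operator norm of the Jacobian, the other
  from the components. Their product bounds \<open>\<parallel>f(y) - f(x)\<parallel>\<^sup>2\<close> and gives the second summand of \<open>C\<^sub>1\<close>.
\<close>

lemma f_x_norm_diff_le:
  assumes "\<theta> \<in> \<Theta>" "x \<in> X" "y \<in> X"
  shows "norm (f y \<theta> - f x \<theta>) \<le> jacobian_bound X \<Theta> f * norm (y - x)"
    and "norm (f y \<theta> - f x \<theta>) \<le> sqrt (real CARD('j)) * (L\<^sub>f\<^sub>x * norm (y - x))"
proof -
  show "norm (f y \<theta> - f x \<theta>) \<le> jacobian_bound X \<Theta> f * norm (y - x)"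
  proof (rule differentiable_bound[OF convex_X, where f' = "\<lambda>z. (*v) (jacobian_x f z \<theta>)"])
    fix z assume z: "z \<in> X"
    then have "(\<lambda>z. f z \<theta>) differentiable (at z)"
      using assms(1) by (intro differentiable_vec_componentwise f_diff)
    then have "((\<lambda>z. f z \<theta>) has_derivative (*v) (jacobian_x f z \<theta>)) (at z)"
      unfolding jacobian_x_def by (rule iffD1[OF jacobian_works])
    then show "((\<lambda>z. f z \<theta>) has_derivative (*v) (jacobian_x f z \<theta>)) (at z within X)"
      by (rule has_derivative_at_withinI)
    show "onorm ((*v) (jacobian_x f z \<theta>)) \<le> jacobian_bound X \<Theta> f"
      using z assms(1) by (rule onorm_jacobian_le)
  qed (use assms in auto)
  show "norm (f y \<theta> - f x \<theta>) \<le> sqrt (real CARD('j)) * (L\<^sub>f\<^sub>x * norm (y - x))"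
    using lipschitz_onD[OF f_Lipschitz_x[OF assms(1)] assms(3,2)] Lipschitz_constants_nonneg
    by (intro norm_le_sqrt_card) (auto simp: dist_norm)
qed

lemma Phi_above_tangent:
  assumes "\<rho> > 0" "\<theta> \<in> \<Theta>" "x \<in> X" "y \<in> X"
  shows "Phi f \<rho> x l \<theta>
      + (transpose (jacobian_x f x \<theta>) *v pos_part (\<rho> *\<^sub>R f x \<theta> + l)) \<bullet> (y - x) \<le> Phi f \<rho> y l \<theta>"
proof -
  define m where "m = pos_part (\<rho> *\<^sub>R f x \<theta> + l)"
  have "aug_term \<rho> (f x \<theta> $ j) (l $ j) + m $ j * (gradient (\<lambda>z. f z \<theta> $ j) x \<bullet> (y - x))
      \<le> aug_term \<rho> (f y \<theta> $ j) (l $ j)" for j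
  proof -
    have "m $ j * (gradient (\<lambda>z. f z \<theta> $ j) x \<bullet> (y - x)) \<le> m $ j * (f y \<theta> $ j - f x \<theta> $ j)"
      using convex_on_above_gradient[OF f_convex[OF assms(2)] assms(3,4) f_diff[OF assms(2,3)], of j]
      by (intro mult_left_mono) (auto simp: m_def)
    then show ?thesis
      using aug_term_above_tangent[OF assms(1), of "f x \<theta> $ j" "l $ j" "f y \<theta> $ j"]
      by (simp add: m_def add.commute)
  qed
  then have "(\<Sum>j\<in>UNIV. aug_term \<rho> (f x \<theta> $ j) (l $ j) + m $ j * (gradient (\<lambda>z. f z \<theta> $ j) x \<bullet> (y - x)))
      \<le> Phi f \<rho> y l \<theta>"
    unfolding Phi_def by (rule sum_mono)
  then show ?thesis
    unfolding Phi_def m_def[symmetric] jacobian_x_def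
    by (subst transpose_jacobian_inner[OF f_diff[OF assms(2,3)]]) (simp add: sum.distrib)
qed

text \<open>
  The curvature has two sources. The bending of each \<open>f\<^sub>j\<close> is weighted by the multiplier estimate
  \<open>[\<rho>f + \<lambda>]\<^sub>+\<close>, whose norm is at most \<open>\<rho> D\<^sub>f + \<parallel>\<lambda>\<parallel>\<close>; the bending of the quadratic penalty contributes
  \<open>\<rho>/2\<close> times the squared variation of \<open>f\<close>.
\<close>

lemma Phi_below_parabola:
  assumes "\<rho> > 0" "0 \<le> l" "\<theta> \<in> \<Theta>" "x \<in> X" "y \<in> X"
  shows "Phi f \<rho> y l \<theta> \<le> Phi f \<rho> x l \<theta>
      + (transpose (jacobian_x f x \<theta>) *v pos_part (\<rho> *\<^sub>R f x \<theta> + l)) \<bullet> (y - x)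
      + (\<rho> * C\<^sub>1 + C\<^sub>2 * norm l) / 2 * (norm (y - x))\<^sup>2"
proof -
  define m where "m = pos_part (\<rho> *\<^sub>R f x \<theta> + l)"
  define q where "q = (norm (y - x))\<^sup>2"
  let ?D = "constraint_bound X \<Theta> f" and ?M = "jacobian_bound X \<Theta> f" and ?s = "sqrt (real CARD('j))"
  have "aug_term \<rho> (f y \<theta> $ j) (l $ j) \<le> aug_term \<rho> (f x \<theta> $ j) (l $ j)
      + m $ j * (gradient (\<lambda>z. f z \<theta> $ j) x \<bullet> (y - x))
      + m $ j * (L\<^sub>d\<^sub>f / 2 * q) + \<rho> / 2 * ((f y \<theta> - f x \<theta>) $ j)\<^sup>2" for j
  proof -
    have "m $ j * (f y \<theta> $ j - f x \<theta> $ j)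
        \<le> m $ j * (gradient (\<lambda>z. f z \<theta> $ j) x \<bullet> (y - x) + L\<^sub>d\<^sub>f / 2 * q)"
      using Lipschitz_gradient_descent[OF convex_X assms(4,5) f_diff[OF assms(3)] f_grad_Lipschitz[OF assms(3)], of j]
      by (intro mult_left_mono) (auto simp: m_def q_def)
    then show ?thesis
      using aug_term_below_parabola[OF assms(1), of "f y \<theta> $ j" "l $ j" "f x \<theta> $ j"]
      by (simp add: m_def add.commute distrib_left)
  qed
  then have "Phi f \<rho> y l \<theta> \<le> (\<Sum>j\<in>UNIV. aug_term \<rho> (f x \<theta> $ j) (l $ j)
      + m $ j * (gradient (\<lambda>z. f z \<theta> $ j) x \<bullet> (y - x))
      + m $ j * (L\<^sub>d\<^sub>f / 2 * q) + \<rho> / 2 * ((f y \<theta> - f x \<theta>) $ j)\<^sup>2)"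
    unfolding Phi_def by (rule sum_mono)
  also have "\<dots> = Phi f \<rho> x l \<theta> + (transpose (jacobian_x f x \<theta>) *v m) \<bullet> (y - x)
      + (\<Sum>j\<in>UNIV. m $ j) * (L\<^sub>d\<^sub>f / 2 * q) + \<rho> / 2 * (norm (f y \<theta> - f x \<theta>))\<^sup>2"
    unfolding Phi_def jacobian_x_def norm_power2_vec
    by (subst transpose_jacobian_inner[OF f_diff[OF assms(3,4)]])
      (simp only: sum.distrib sum_distrib_left[symmetric] sum_distrib_right[symmetric])
  also have "\<dots> \<le> Phi f \<rho> x l \<theta> + (transpose (jacobian_x f x \<theta>) *v m) \<bullet> (y - x)
      + (?s * (\<rho> * ?D + norm l)) * (L\<^sub>d\<^sub>f / 2 * q) + \<rho> / 2 * (?s * L\<^sub>f\<^sub>x * ?M * q)"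
  proof -
    have "(\<Sum>j\<in>UNIV. m $ j) \<le> ?s * norm m"
      using sum_abs_le_sqrt_card_norm[of m] by (simp add: m_def)
    also have "norm m \<le> \<rho> * norm (pos_part (f x \<theta>)) + norm l"
      unfolding m_def using assms(1,2) by (intro norm_pos_part_shift_le) auto
    also have "\<dots> \<le> \<rho> * ?D + norm l"
      using norm_pos_part_f_le[OF assms(4,3)] assms(1) by simp
    finally have "(\<Sum>j\<in>UNIV. m $ j) \<le> ?s * (\<rho> * ?D + norm l)"
      by (simp add: mult_left_mono)
    moreover have "(norm (f y \<theta> - f x \<theta>))\<^sup>2 \<le> ?s * L\<^sub>f\<^sub>x * ?M * q"
    proof -
      have "norm (f y \<theta> - f x \<theta>) * norm (f y \<theta> - f x \<theta>)
          \<le> (?M * norm (y - x)) * (?s * (L\<^sub>f\<^sub>x * norm (y - x)))"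
        using f_x_norm_diff_le[OF assms(3-5)]
        by (intro mult_mono) (auto intro: order_trans[OF norm_ge_zero])
      then show ?thesis by (simp add: q_def power2_eq_square algebra_simps)
    qed
    ultimately show ?thesis
      using assms(1) Lipschitz_constants_nonneg
      by (intro add_mono mult_right_mono mult_left_mono order_refl) (auto simp: q_def)
  qed
  also have "\<dots> = Phi f \<rho> x l \<theta> + (transpose (jacobian_x f x \<theta>) *v m) \<bullet> (y - x)
      + (\<rho> * C\<^sub>1 + C\<^sub>2 * norm l) / 2 * q"
    by (simp add: C\<^sub>1_def C\<^sub>2_def field_simps)
  finally show ?thesis by (simp add: m_def q_def)
qed

lemma Phi_multiplier_step:
  assumes "\<rho> > 0"
  shows "(norm (pos_part (l + \<rho> *\<^sub>R f x \<theta>) - ls))\<^sup>2 / (2 * \<rho>) - (norm (l - ls))\<^sup>2 / (2 * \<rho>)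
    \<le> Phi f \<rho> x l \<theta> - ls \<bullet> f x \<theta>"
proof -
  have "(\<Sum>j\<in>UNIV. ((max 0 (l $ j + \<rho> * f x \<theta> $ j) - ls $ j)\<^sup>2 - (l $ j - ls $ j)\<^sup>2) / (2 * \<rho>))
      \<le> (\<Sum>j\<in>UNIV. aug_term \<rho> (f x \<theta> $ j) (l $ j) - ls $ j * f x \<theta> $ j)"
    using aug_term_dual_step[OF assms ls_nonneg] by (intro sum_mono) blast
  then show ?thesis
    by (simp add: Phi_def norm_power2_vec inner_vec_def sum_subtractf sum_divide_distrib diff_divide_distrib)
qed

lemma f_\<theta>_diff_le:
  assumes "x \<in> X" "\<theta> \<in> \<Theta>"
  shows "\<bar>f x \<theta> $ j - f x \<theta>s $ j\<bar> \<le> L\<^sub>f\<^sub>\<theta> * norm (\<theta> - \<theta>s)"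
  using lipschitz_onD[OF f_Lipschitz_\<theta>[OF assms(1)] assms(2) \<theta>s_in, of j] by (simp add: dist_norm)

text \<open>
  At the true parameter \<open>x\<^sup>*\<close> is feasible and the left-hand side is nonpositive. Under another parameter
  each constraint is violated by at most the Lipschitz constant times the parameter error. One factor of
  the squared error is bounded by the diameter, which makes the whole bound linear in the error.
\<close>

lemma Phi_at_solution_le:
  assumes "\<rho> > 0" "0 \<le> l" "\<theta> \<in> \<Theta>"
  shows "Phi f \<rho> xs l \<theta> \<le> real CARD('j) *
    (L\<^sub>f\<^sub>\<theta> * norm l + \<rho> / 2 * L\<^sub>f\<^sub>\<theta>\<^sup>2 * diameter \<Theta>) * norm (\<theta> - \<theta>s)"
proof -
  let ?e = "norm (\<theta> - \<theta>s)"
  have "aug_term \<rho> (f xs \<theta> $ j) (l $ j)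
      \<le> (L\<^sub>f\<^sub>\<theta> * norm l + \<rho> / 2 * L\<^sub>f\<^sub>\<theta>\<^sup>2 * diameter \<Theta>) * ?e" for j
  proof -
    have "aug_term \<rho> (f xs \<theta> $ j) (l $ j) \<le> (L\<^sub>f\<^sub>\<theta> * ?e) * l $ j + \<rho> / 2 * (L\<^sub>f\<^sub>\<theta> * ?e)\<^sup>2"
      using f_\<theta>_diff_le[OF xs_in assms(3), of j] f_xs_le_0[of j] assms Lipschitz_constants_nonneg
      by (intro aug_term_le) (auto simp: less_eq_vec_def)
    also have "\<dots> \<le> (L\<^sub>f\<^sub>\<theta> * ?e) * norm l + \<rho> / 2 * (L\<^sub>f\<^sub>\<theta>\<^sup>2 * (diameter \<Theta> * ?e))"
      using component_le_norm_cart[of l j] assms(1) Lipschitz_constants_nonneg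
        norm_diff_le_diameter(2)[OF assms(3) \<theta>s_in]
      by (intro add_mono mult_left_mono)
        (auto simp: power_mult_distrib power2_eq_square[of ?e] intro!: mult_left_mono mult_right_mono)
    finally show ?thesis by (simp add: algebra_simps)
  qed
  then have "Phi f \<rho> xs l \<theta> \<le> (\<Sum>j\<in>(UNIV :: 'j set). (L\<^sub>f\<^sub>\<theta> * norm l + \<rho> / 2 * L\<^sub>f\<^sub>\<theta>\<^sup>2 * diameter \<Theta>) * ?e)"
    unfolding Phi_def by (rule sum_mono)
  then show ?thesis by (simp add: mult.assoc)
qed

text \<open>
  Stationarity pairs \<open>F\<close> with the gradients of the constraints. Convexity replaces these by the values of
  \<open>f\<close>, and complementarity removes the value at \<open>x\<^sup>*\<close>.
\<close>

lemma KKT_variational_inequality: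
  assumes "x \<in> X"
  shows "0 \<le> F xs \<theta>s \<bullet> (x - xs) + ls \<bullet> f x \<theta>s"
proof -
  obtain v where v: "v \<in> normal_cone X xs" "F xs \<theta>s + transpose (jacobian_x f xs \<theta>s) *v ls + v = 0"
    using KKT_point by (auto simp: KKT_def)
  have "v \<bullet> (x - xs) \<le> 0"
    using v(1) assms by (auto simp: normal_cone_def split: if_splits)
  moreover have "F xs \<theta>s \<bullet> (x - xs) + (transpose (jacobian_x f xs \<theta>s) *v ls) \<bullet> (x - xs) + v \<bullet> (x - xs) = 0"
    using arg_cong[OF v(2), of "\<lambda>w. w \<bullet> (x - xs)"] by (simp add: inner_add_left)
  moreover have "(transpose (jacobian_x f xs \<theta>s) *v ls) \<bullet> (x - xs) \<le> (\<Sum>j\<in>UNIV. ls $ j * (f x \<theta>s $ j - f xs \<theta>s $ j))"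
    unfolding jacobian_x_def transpose_jacobian_inner[OF f_diff[OF \<theta>s_in xs_in]]
    using convex_on_above_gradient[OF f_convex[OF \<theta>s_in] xs_in assms f_diff[OF \<theta>s_in xs_in]] ls_nonneg
    by (intro sum_mono mult_left_mono) (auto simp: le_diff_eq add.commute)
  moreover have "(\<Sum>j\<in>UNIV. ls $ j * (f x \<theta>s $ j - f xs \<theta>s $ j)) = ls \<bullet> f x \<theta>s"
  proof -
    have "ls \<bullet> f xs \<theta>s = 0"
      using KKT_point by (simp add: KKT_def orthogonal_def)
    then show ?thesis by (simp add: inner_vec_def right_diff_distrib sum_subtractf)
  qed
  ultimately show ?thesis by linarith
qed

text \<open>
  Monotonicity compares the two points under the same parameter, after which only the parameter of the
  value at \<open>x\<^sup>*\<close> has to be exchanged.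
\<close>

lemma F_at_iterate_lower_bound:
  assumes "x \<in> X" "\<theta> \<in> \<Theta>"
  shows "F xs \<theta>s \<bullet> (x - xs) - L\<^sub>F\<^sub>\<theta> * diameter X * norm (\<theta> - \<theta>s) \<le> F x \<theta> \<bullet> (x - xs)"
proof -
  have "0 \<le> (F x \<theta> - F xs \<theta>) \<bullet> (x - xs)"
    using F_mono[OF assms(2)] assms(1) xs_in by (auto simp: monotone_map_on_def)
  moreover have "(F xs \<theta>s - F xs \<theta>) \<bullet> (x - xs) \<le> L\<^sub>F\<^sub>\<theta> * norm (\<theta> - \<theta>s) * diameter X"
  proof -
    have "(F xs \<theta>s - F xs \<theta>) \<bullet> (x - xs) \<le> norm (F xs \<theta>s - F xs \<theta>) * norm (x - xs)"
      by (rule norm_cauchy_schwarz)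
    also have "\<dots> \<le> (L\<^sub>F\<^sub>\<theta> * norm (\<theta> - \<theta>s)) * diameter X"
      using lipschitz_onD[OF F_Lipschitz_\<theta>[OF xs_in] \<theta>s_in assms(2)] norm_diff_le_diameter(1)[OF assms(1) xs_in]
        Lipschitz_constants_nonneg
      by (intro mult_mono) (auto simp: dist_norm norm_minus_commute)
    finally show ?thesis .
  qed
  ultimately show ?thesis by (simp add: inner_diff_left algebra_simps)
qed

lemma F_norm_diff_le:
  assumes "x \<in> X" "y \<in> X" "\<theta> \<in> \<Theta>" "\<theta>' \<in> \<Theta>"
  shows "norm (F x \<theta> - F y \<theta>') \<le> L\<^sub>F\<^sub>x * norm (x - y) + L\<^sub>F\<^sub>\<theta> * norm (\<theta> - \<theta>')"
proof -
  have "norm (F x \<theta> - F y \<theta>') \<le> norm (F x \<theta> - F y \<theta>) + norm (F y \<theta> - F y \<theta>')"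
    using norm_triangle_ineq[of "F x \<theta> - F y \<theta>" "F y \<theta> - F y \<theta>'"] by simp
  then show ?thesis
    using lipschitz_onD[OF F_Lipschitz_x[OF assms(3)] assms(1,2)]
      lipschitz_onD[OF F_Lipschitz_\<theta>[OF assms(2)] assms(3,4)]
    by (simp add: dist_norm)
qed

lemma multiplier_pairing_\<theta>_le:
  assumes "x \<in> X" "\<theta> \<in> \<Theta>"
  shows "ls \<bullet> f x \<theta>s \<le> ls \<bullet> f x \<theta> + real CARD('j) * L\<^sub>f\<^sub>\<theta> * norm ls * norm (\<theta> - \<theta>s)"
proof -
  have "ls $ j * f x \<theta>s $ j \<le> ls $ j * f x \<theta> $ j + norm ls * (L\<^sub>f\<^sub>\<theta> * norm (\<theta> - \<theta>s))" for j
  proof -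
    have "ls $ j * (f x \<theta>s $ j - f x \<theta> $ j) \<le> norm ls * (L\<^sub>f\<^sub>\<theta> * norm (\<theta> - \<theta>s))"
      using f_\<theta>_diff_le[OF assms, of j] component_le_norm_cart[of ls j] ls_nonneg[of j]
        Lipschitz_constants_nonneg
      by (intro order_trans[OF mult_left_mono mult_right_mono]) auto
    then show ?thesis by (simp add: algebra_simps)
  qed
  then have "(\<Sum>j\<in>UNIV. ls $ j * f x \<theta>s $ j)
      \<le> (\<Sum>j\<in>UNIV. ls $ j * f x \<theta> $ j + norm ls * (L\<^sub>f\<^sub>\<theta> * norm (\<theta> - \<theta>s)))"
    by (rule sum_mono)
  then show ?thesis by (simp add: inner_vec_def sum.distrib algebra_simps)
qed

end

section \<open>The energy of the iteration\<close>

locale ALM_run = misspecified_problem +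
  fixes \<rho> \<gamma> :: real and \<eta> :: "nat \<Rightarrow> real"
    and x :: "nat \<Rightarrow> real^'a" and \<theta> :: "nat \<Rightarrow> real^'b" and l :: "nat \<Rightarrow> real^'c"
  assumes \<rho>_pos: "\<rho> > 0" and \<gamma>_pos: "\<gamma> > 0"
    and iterates: "ALM_iterates X \<Theta> F H f (\<lambda>_. \<rho>) (\<lambda>_. \<gamma>) \<eta> x \<theta> l"
    and closed_\<Theta>: "closed \<Theta>"
begin

definition "r k = F (x k) (\<theta> k) - F (x (k - 1)) (\<theta> (k - 1))"

text \<open>
  The last two terms carry the operator extrapolation: the square pays for the part of
  \<open>\<langle>r\<^sub>k, x\<^sub>k\<^sub>+\<^sub>1 - x\<^sub>k\<rangle>\<close> caused by the previous primal step, and the inner product telescopes.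
\<close>

definition "energy k = (norm (x k - xs))\<^sup>2 / (2 * \<gamma>) + (norm (l k - ls))\<^sup>2 / (2 * \<rho>)
  + L\<^sub>F\<^sub>x / 2 * (norm (x k - x (k - 1)))\<^sup>2 - r k \<bullet> (x k - xs)"

definition "drift k = norm (\<theta> (k - 1) - \<theta>s) + norm (\<theta> k - \<theta>s) + norm (\<theta> (Suc k) - \<theta>s)"

lemma x_Suc: "x (Suc k) = closest_point X (x k - \<gamma> *\<^sub>R (F (x k) (\<theta> k) + r k
    + transpose (jacobian_x f (x k) (\<theta> k)) *v pos_part (\<rho> *\<^sub>R f (x k) (\<theta> k) + l k)))"
  and l_Suc: "l (Suc k) = pos_part (l k + \<rho> *\<^sub>R f (x (Suc k)) (\<theta> k))"
  and l_0: "l 0 = 0"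
  using iterates by (auto simp: ALM_iterates_def r_def Let_def)

lemma x_in: "x k \<in> X"
proof (cases k)
  case 0
  then show ?thesis using iterates by (simp add: ALM_iterates_def)
next
  case (Suc i)
  then show ?thesis
    using closest_point_in_set[OF compact_imp_closed[OF compact_X]] xs_in
    by (auto simp: x_Suc)
qed

lemma \<theta>_in: "\<theta> k \<in> \<Theta>"
proof (cases k)
  case 0
  then show ?thesis using iterates by (simp add: ALM_iterates_def)
next
  case (Suc i)
  then have "\<theta> k = closest_point \<Theta> (\<theta> i - \<eta> i *\<^sub>R H (\<theta> i))"
    using iterates by (auto simp: ALM_iterates_def Let_def)
  then show ?thesis
    using closest_point_in_set[OF closed_\<Theta>] \<theta>s_in by auto
qed

lemma l_nonneg: "0 \<le> l k"
  by (cases k) (auto simp: l_0 l_Suc less_eq_vec_def)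

text \<open>
  By the inequality of the means the product of two consecutive step lengths splits into half their
  squares, one of which belongs to the energy at \<open>k\<close> and the other to the energy at \<open>k + 1\<close>.
\<close>

lemma r_inner_step_lower_bound:
  "- (L\<^sub>F\<^sub>x / 2 * (norm (x k - x (k - 1)))\<^sup>2) - L\<^sub>F\<^sub>x / 2 * (norm (x (Suc k) - x k))\<^sup>2
    - L\<^sub>F\<^sub>\<theta> * diameter X * (norm (\<theta> (k - 1) - \<theta>s) + norm (\<theta> k - \<theta>s)) \<le> r k \<bullet> (x (Suc k) - x k)"
proof -
  let ?a = "norm (x k - x (k - 1))" and ?b = "norm (x (Suc k) - x k)"
  let ?e = "norm (\<theta> (k - 1) - \<theta>s) + norm (\<theta> k - \<theta>s)"
  have "- (r k \<bullet> (x (Suc k) - x k)) \<le> norm (r k) * ?b"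
    using Cauchy_Schwarz_ineq2[of "r k" "x (Suc k) - x k"] by linarith
  also have "norm (r k) \<le> L\<^sub>F\<^sub>x * ?a + L\<^sub>F\<^sub>\<theta> * ?e"
  proof -
    have "norm (\<theta> k - \<theta> (k - 1)) \<le> ?e"
      using norm_triangle_ineq4[of "\<theta> k - \<theta>s" "\<theta> (k - 1) - \<theta>s"] by simp
    then have "L\<^sub>F\<^sub>\<theta> * norm (\<theta> k - \<theta> (k - 1)) \<le> L\<^sub>F\<^sub>\<theta> * ?e"
      using Lipschitz_constants_nonneg by (intro mult_left_mono)
    moreover have "norm (r k) \<le> L\<^sub>F\<^sub>x * ?a + L\<^sub>F\<^sub>\<theta> * norm (\<theta> k - \<theta> (k - 1))"
      unfolding r_def by (rule F_norm_diff_le[OF x_in x_in \<theta>_in \<theta>_in])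
    ultimately show ?thesis by linarith
  qed
  then have "norm (r k) * ?b \<le> (L\<^sub>F\<^sub>x * ?a + L\<^sub>F\<^sub>\<theta> * ?e) * ?b"
    by (intro mult_right_mono) auto
  also have "\<dots> = L\<^sub>F\<^sub>x * (?a * ?b) + L\<^sub>F\<^sub>\<theta> * ?e * ?b"
    by (simp add: algebra_simps)
  also have "\<dots> \<le> L\<^sub>F\<^sub>x * ((?a\<^sup>2 + ?b\<^sup>2) / 2) + L\<^sub>F\<^sub>\<theta> * ?e * diameter X"
    using Lipschitz_constants_nonneg sum_squares_bound[of ?a ?b] norm_diff_le_diameter(1)[OF x_in x_in]
    by (intro add_mono mult_left_mono) auto
  finally show ?thesis by (simp add: field_simps)
qed

text \<open>
  The three-point inequality of the projection is combined with the Lagrangian estimates. The step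
  size condition says precisely that \<open>1 / (2\<gamma>)\<close> is at least half the curvature bound of
  \<open>\<Phi>\<^sub>\<rho>\<close> plus \<open>L\<^sub>F\<^sub>,\<^sub>x\<close>, where one half of the latter is spent at this step and the other is handed on to the next one.
\<close>

lemma energy_step:
  assumes D: "norm (l k - ls) \<le> D"
    and step: "\<gamma> * (\<rho> * C\<^sub>1 + C\<^sub>2 * (norm ls + D) + 2 * L\<^sub>F\<^sub>x) \<le> 1"
  shows "energy (Suc k) \<le> energy k
    + (L\<^sub>F\<^sub>\<theta> * diameter X + real CARD('c) *
        (L\<^sub>f\<^sub>\<theta> * (2 * norm ls + D) + \<rho> / 2 * L\<^sub>f\<^sub>\<theta>\<^sup>2 * diameter \<Theta>)) * drift k"
proof -
  let ?x = "x k" and ?y = "x (Suc k)" and ?\<theta> = "\<theta> k" and ?l = "l k"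
  let ?e = "\<lambda>k. norm (\<theta> k - \<theta>s)" and ?J = "real CARD('c)"
  let ?G = "transpose (jacobian_x f ?x ?\<theta>) *v pos_part (\<rho> *\<^sub>R f ?x ?\<theta> + ?l)"
  define q where "q = (norm (?y - ?x))\<^sup>2"
  have norm_l: "norm ?l \<le> norm ls + D"
    using D norm_triangle_ineq2[of ?l ls] by linarith
  have "(F ?x ?\<theta> + r k + ?G) \<bullet> (?y - xs)
      \<le> ((norm (?x - xs))\<^sup>2 - (norm (?y - xs))\<^sup>2 - q) / (2 * \<gamma>)"
    unfolding q_def using projection_step[OF convex_X compact_imp_closed[OF compact_X] xs_in \<gamma>_pos x_Suc] .
  then have proj: "(F ?x ?\<theta> + r k + ?G) \<bullet> (?y - xs)
      \<le> (norm (?x - xs))\<^sup>2 / (2 * \<gamma>) - (norm (?y - xs))\<^sup>2 / (2 * \<gamma>) - q / (2 * \<gamma>)"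
    by (simp add: diff_divide_distrib)
  \<comment> \<open>moving \<open>F\<close> to the new point costs \<open>r (Suc k)\<close>, which telescopes against \<open>r k\<close> at the old point\<close>
  have split: "(F ?x ?\<theta> + r k + ?G) \<bullet> (?y - xs) =
      F ?y (\<theta> (Suc k)) \<bullet> (?y - xs) - r (Suc k) \<bullet> (?y - xs)
      + r k \<bullet> (?x - xs) + r k \<bullet> (?y - ?x) + ?G \<bullet> (?y - ?x) - ?G \<bullet> (xs - ?x)"
    unfolding r_def diff_Suc_1 inner_add_left inner_diff_left inner_diff_right by simp
  have "(\<rho> * C\<^sub>1 + C\<^sub>2 * norm ?l) / 2 * q + L\<^sub>F\<^sub>x * q \<le> q / (2 * \<gamma>)"
  proof -
    have "\<rho> * C\<^sub>1 + C\<^sub>2 * norm ?l + 2 * L\<^sub>F\<^sub>x \<le> \<rho> * C\<^sub>1 + C\<^sub>2 * (norm ls + D) + 2 * L\<^sub>F\<^sub>x"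
      using mult_left_mono[OF norm_l C2_nonneg] by simp
    also have "\<dots> \<le> 1 / \<gamma>" using step \<gamma>_pos by (simp add: field_simps)
    finally have "(\<rho> * C\<^sub>1 + C\<^sub>2 * norm ?l + 2 * L\<^sub>F\<^sub>x) * (q / 2) \<le> 1 / \<gamma> * (q / 2)"
      by (rule mult_right_mono) (simp add: q_def)
    then show ?thesis by (simp add: algebra_simps add_divide_distrib)
  qed
  moreover have "?J * (L\<^sub>f\<^sub>\<theta> * norm ?l + \<rho> / 2 * L\<^sub>f\<^sub>\<theta>\<^sup>2 * diameter \<Theta>) * ?e k
      \<le> ?J * (L\<^sub>f\<^sub>\<theta> * (norm ls + D) + \<rho> / 2 * L\<^sub>f\<^sub>\<theta>\<^sup>2 * diameter \<Theta>) * ?e k"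
    using norm_l Lipschitz_constants_nonneg diameter_nonneg
    by (intro mult_right_mono mult_left_mono add_right_mono) auto
  ultimately have "energy (Suc k) \<le> energy k + L\<^sub>F\<^sub>\<theta> * diameter X * drift k
      + ?J * (L\<^sub>f\<^sub>\<theta> * (norm ls + D) + \<rho> / 2 * L\<^sub>f\<^sub>\<theta>\<^sup>2 * diameter \<Theta>) * ?e k
      + ?J * L\<^sub>f\<^sub>\<theta> * norm ls * ?e k"
    using proj split r_inner_step_lower_bound[of k]
      F_at_iterate_lower_bound[of ?y "\<theta> (Suc k)", OF x_in \<theta>_in]
      KKT_variational_inequality[of ?y, OF x_in]
      multiplier_pairing_\<theta>_le[of ?y ?\<theta>, OF x_in \<theta>_in]
      Phi_above_tangent[of \<rho> ?\<theta> ?x xs ?l, OF \<rho>_pos \<theta>_in x_in xs_in]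
      Phi_below_parabola[of \<rho> ?l ?\<theta> ?x ?y, OF \<rho>_pos l_nonneg \<theta>_in x_in x_in]
      Phi_at_solution_le[of \<rho> ?l ?\<theta>, OF \<rho>_pos l_nonneg \<theta>_in]
      Phi_multiplier_step[of \<rho> ?l ?y ?\<theta>, OF \<rho>_pos]
    unfolding q_def energy_def drift_def l_Suc[symmetric]
    by (simp add: distrib_left)
  also have "\<dots> = energy k + L\<^sub>F\<^sub>\<theta> * diameter X * drift k
      + ?J * (L\<^sub>f\<^sub>\<theta> * (2 * norm ls + D) + \<rho> / 2 * L\<^sub>f\<^sub>\<theta>\<^sup>2 * diameter \<Theta>) * ?e k"
    by (simp add: algebra_simps)
  also have "\<dots> \<le> energy k + L\<^sub>F\<^sub>\<theta> * diameter X * drift k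
      + ?J * (L\<^sub>f\<^sub>\<theta> * (2 * norm ls + D) + \<rho> / 2 * L\<^sub>f\<^sub>\<theta>\<^sup>2 * diameter \<Theta>) * drift k"
  proof -
    have "0 \<le> D" using order_trans[OF norm_ge_zero D] .
    then show ?thesis
      using Lipschitz_constants_nonneg diameter_nonneg \<rho>_pos
      by (intro add_left_mono mult_left_mono) (auto simp: drift_def)
  qed
  finally show ?thesis by (simp add: algebra_simps)
qed

lemma sum_drift_le:
  assumes "summable (\<lambda>k. norm (\<theta> k - \<theta>s))"
  shows "(\<Sum>k<n. drift k) \<le> 4 * (\<Sum>k. norm (\<theta> k - \<theta>s))"
proof -
  let ?e = "\<lambda>k. norm (\<theta> k - \<theta>s)"
  have partial: "(\<Sum>k<m. ?e k) \<le> suminf ?e" for m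
    using assms by (intro sum_le_suminf) auto
  have "?e 0 \<le> suminf ?e"
    using partial[of 1] by simp
  have "(\<Sum>k<n. ?e (k - 1)) \<le> ?e 0 + suminf ?e"
  proof (cases n)
    case 0
    then show ?thesis using partial[of 0] by simp
  next
    case (Suc m)
    then show ?thesis using partial[of m] by (simp add: sum.lessThan_Suc_shift del: sum.lessThan_Suc)
  qed
  moreover have "(\<Sum>k<n. ?e (Suc k)) \<le> suminf ?e"
    using partial[of "Suc n"] sum.lessThan_Suc_shift[of ?e n] norm_ge_zero[of "\<theta> 0 - \<theta>s"]
    by linarith
  ultimately show ?thesis
    using partial[of n] \<open>?e 0 \<le> suminf ?e\<close> unfolding drift_def sum.distrib by linarith
qed

text \<open>
  The energy controls \<open>\<parallel>\<lambda>\<^sub>k - \<lambda>\<^sup>*\<parallel>\<^sup>2 / (2\<rho>)\<close> up to its only possibly negative term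
  \<open>- \<langle>r\<^sub>k, x\<^sub>k - x\<^sup>*\<rangle>\<close>, which is bounded by compactness. Strong induction supplies the bound \<open>D\<close> that
  each of the earlier energy steps needs.
\<close>

lemma multiplier_distance_le:
  assumes "summable (\<lambda>k. norm (\<theta> k - \<theta>s))" "0 \<le> D"
    and step: "\<gamma> * (\<rho> * C\<^sub>1 + C\<^sub>2 * (norm ls + D) + 2 * L\<^sub>F\<^sub>x) \<le> 1"
    and large: "(norm ls)\<^sup>2 + \<rho> * (diameter X)\<^sup>2 / \<gamma>
      + 2 * \<rho> * ((L\<^sub>F\<^sub>x * diameter X + L\<^sub>F\<^sub>\<theta> * diameter \<Theta>) * diameter X
        + (L\<^sub>F\<^sub>\<theta> * diameter X + real CARD('c) *
            (L\<^sub>f\<^sub>\<theta> * (2 * norm ls + D) + \<rho> / 2 * L\<^sub>f\<^sub>\<theta>\<^sup>2 * diameter \<Theta>))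
          * (4 * (\<Sum>k. norm (\<theta> k - \<theta>s)))) \<le> D\<^sup>2"
  shows "norm (l k - ls) \<le> D"
proof (induction k rule: less_induct)
  case (less k)
  let ?R = "diameter X"
  define K where "K = L\<^sub>F\<^sub>\<theta> * ?R + real CARD('c) *
    (L\<^sub>f\<^sub>\<theta> * (2 * norm ls + D) + \<rho> / 2 * L\<^sub>f\<^sub>\<theta>\<^sup>2 * diameter \<Theta>)"
  define B where "B = (L\<^sub>F\<^sub>x * ?R + L\<^sub>F\<^sub>\<theta> * diameter \<Theta>) * ?R"
  define S where "S = (\<Sum>k. norm (\<theta> k - \<theta>s))"
  have "energy n \<le> energy 0 + K * (\<Sum>i<n. drift i)" if "n \<le> k" for n
    using that
  proof (induction n)
    case (Suc n)
    then have "energy (Suc n) \<le> energy n + K * drift n"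
      unfolding K_def by (intro energy_step step less) simp
    then show ?case
      using Suc by (simp add: distrib_left)
  qed simp
  then have "energy k \<le> energy 0 + K * (\<Sum>i<k. drift i)" by blast
  also have "K * (\<Sum>i<k. drift i) \<le> K * (4 * S)"
    unfolding S_def using assms(1,2) diameter_nonneg Lipschitz_constants_nonneg \<rho>_pos
    by (intro mult_left_mono sum_drift_le) (auto simp: K_def)
  finally have energy_k: "energy k \<le> energy 0 + K * (4 * S)" by simp
  have "energy 0 = (norm (x 0 - xs))\<^sup>2 / (2 * \<gamma>) + (norm ls)\<^sup>2 / (2 * \<rho>)"
    by (simp add: energy_def r_def l_0)
  also have "\<dots> \<le> ?R\<^sup>2 / (2 * \<gamma>) + (norm ls)\<^sup>2 / (2 * \<rho>)"
    using norm_diff_le_diameter(1)[OF x_in xs_in, of 0] \<gamma>_pos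
    by (intro add_right_mono divide_right_mono power_mono) auto
  finally have energy_0: "energy 0 \<le> ?R\<^sup>2 / (2 * \<gamma>) + (norm ls)\<^sup>2 / (2 * \<rho>)" .
  have "r k \<bullet> (x k - xs) \<le> B"
  proof -
    have "norm (r k) \<le> L\<^sub>F\<^sub>x * norm (x k - x (k - 1)) + L\<^sub>F\<^sub>\<theta> * norm (\<theta> k - \<theta> (k - 1))"
      unfolding r_def by (rule F_norm_diff_le[OF x_in x_in \<theta>_in \<theta>_in])
    also have "\<dots> \<le> L\<^sub>F\<^sub>x * ?R + L\<^sub>F\<^sub>\<theta> * diameter \<Theta>"
      using norm_diff_le_diameter x_in \<theta>_in Lipschitz_constants_nonneg
      by (intro add_mono mult_left_mono) auto
    finally have "norm (r k) * norm (x k - xs) \<le> B"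
      unfolding B_def using norm_diff_le_diameter(1)[OF x_in xs_in] diameter_nonneg Lipschitz_constants_nonneg
      by (intro mult_mono) auto
    then show ?thesis using norm_cauchy_schwarz order_trans by blast
  qed
  moreover have "0 \<le> (norm (x k - xs))\<^sup>2 / (2 * \<gamma>)" "0 \<le> L\<^sub>F\<^sub>x / 2 * (norm (x k - x (k - 1)))\<^sup>2"
    using \<gamma>_pos Lipschitz_constants_nonneg by auto
  ultimately have "(norm (l k - ls))\<^sup>2 / (2 * \<rho>) \<le> energy k + B"
    unfolding energy_def by linarith
  also have "\<dots> \<le> ?R\<^sup>2 / (2 * \<gamma>) + (norm ls)\<^sup>2 / (2 * \<rho>) + K * (4 * S) + B"
    using energy_k energy_0 by linarith
  finally have "(norm (l k - ls))\<^sup>2 / (2 * \<rho>) * (2 * \<rho>)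
      \<le> (?R\<^sup>2 / (2 * \<gamma>) + (norm ls)\<^sup>2 / (2 * \<rho>) + K * (4 * S) + B) * (2 * \<rho>)"
    using \<rho>_pos by (intro mult_right_mono) auto
  also have "\<dots> = (norm ls)\<^sup>2 + \<rho> * ?R\<^sup>2 / \<gamma> + 2 * \<rho> * (B + K * (4 * S))"
    using \<rho>_pos \<gamma>_pos by (simp add: field_simps)
  also have "\<dots> \<le> D\<^sup>2"
    using large by (simp only: K_def B_def S_def)
  finally have "(norm (l k - ls))\<^sup>2 \<le> D\<^sup>2" using \<rho>_pos by simp
  then show ?case using assms(2) by (rule power2_le_imp_le)
qed

end

section \<open>The choice of the radius\<close>

text \<open>
  For \<open>C > 0\<close> the radius is the one that exhausts the step size condition, \<open>A + C D = 1/\<gamma>\<close>: the term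
  \<open>a/\<gamma>\<close> then becomes affine in \<open>D\<close>, uniformly in \<open>\<gamma>\<close>, and \<open>D \<ge> D\<^sub>0\<close> follows from the assumption on \<open>\<gamma>\<close>.
  For \<open>C = 0\<close> the condition does not restrict the radius, which may then depend on \<open>\<gamma>\<close> freely.
\<close>

lemma exists_radius:
  fixes a A C E\<^sub>0 E\<^sub>1 :: real
  assumes "a \<ge> 0" "C \<ge> 0"
  shows "\<exists>D\<^sub>0>0. \<forall>\<gamma>>0. \<gamma> * (A + C * D\<^sub>0) < 1 \<longrightarrow>
    (\<exists>D>0. \<gamma> * (A + C * D) \<le> 1 \<and> E\<^sub>0 + E\<^sub>1 * D + a / \<gamma> \<le> D\<^sup>2)"
proof -
  have quadratic: "p + s * D \<le> D\<^sup>2" if "1 + \<bar>p\<bar> + \<bar>s\<bar> \<le> D" for p s D :: real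
  proof -
    have "(1 + \<bar>p\<bar> + \<bar>s\<bar>) * D \<le> D * D"
      using that by (intro mult_right_mono) auto
    moreover have "\<bar>p\<bar> * 1 \<le> \<bar>p\<bar> * D"
      using that by (intro mult_left_mono) auto
    moreover have "s * D \<le> \<bar>s\<bar> * D" "0 \<le> D"
      using that by (auto intro!: mult_right_mono)
    ultimately show ?thesis by (simp add: power2_eq_square algebra_simps)
  qed
  \<comment> \<open>the coefficients of the quadratic inequality after substituting \<open>1/\<gamma> = A + C D\<close>\<close>
  define D\<^sub>0 where "D\<^sub>0 = 1 + \<bar>E\<^sub>0 + a * A\<bar> + \<bar>E\<^sub>1 + a * C\<bar>"
  have "\<exists>D>0. \<gamma> * (A + C * D) \<le> 1 \<and> E\<^sub>0 + E\<^sub>1 * D + a / \<gamma> \<le> D\<^sup>2"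
    if \<gamma>: "\<gamma> > 0" "\<gamma> * (A + C * D\<^sub>0) < 1" for \<gamma>
  proof (cases "C = 0")
    case True
    define D where "D = 1 + \<bar>E\<^sub>0 + a / \<gamma>\<bar> + \<bar>E\<^sub>1\<bar>"
    have "D > 0" by (simp add: D_def)
    moreover have "\<gamma> * (A + C * D) \<le> 1" using \<gamma> True by simp
    moreover have "E\<^sub>0 + E\<^sub>1 * D + a / \<gamma> \<le> D\<^sup>2"
      using quadratic[of "E\<^sub>0 + a / \<gamma>" E\<^sub>1 D] by (simp add: D_def)
    ultimately show ?thesis by blast
  next
    case False
    then have "C > 0" using assms by simp
    define D where "D = (1 / \<gamma> - A) / C"
    have D: "A + C * D = 1 / \<gamma>" using \<open>C > 0\<close> by (simp add: D_def)
    have "A + C * D\<^sub>0 < 1 / \<gamma>" using \<gamma> by (simp add: field_simps)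
    then have "C * D\<^sub>0 < C * D" using D by simp
    then have "D\<^sub>0 < D" using \<open>C > 0\<close> by simp
    then have "(E\<^sub>0 + a * A) + (E\<^sub>1 + a * C) * D \<le> D\<^sup>2"
      by (intro quadratic) (simp add: D\<^sub>0_def)
    moreover have "a / \<gamma> = a * (A + C * D)" by (simp add: D)
    ultimately have "E\<^sub>0 + E\<^sub>1 * D + a / \<gamma> \<le> D\<^sup>2" by (simp add: algebra_simps)
    moreover have "D > 0" using \<open>D\<^sub>0 < D\<close> by (simp add: D\<^sub>0_def)
    moreover have "\<gamma> * (A + C * D) \<le> 1" using D \<gamma> by simp
    ultimately show ?thesis by blast
  qed
  then show ?thesis by (intro exI[of _ D\<^sub>0]) (auto simp: D\<^sub>0_def)
qed

section \<open>Boundedness of the multipliers\<close>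

theorem lemma4p4:
  fixes b :: "'n::finite \<Rightarrow> 'i::finite"
    and Xs :: "'i \<Rightarrow> (real^'n) set"
    and X :: "(real^'n) set"
    and \<Theta> :: "(real^'m) set"
    and F :: "real^'n \<Rightarrow> real^'m \<Rightarrow> real^'n"
    and H :: "real^'m \<Rightarrow> real^'m"
    and f :: "real^'n \<Rightarrow> real^'m \<Rightarrow> real^'j"
    and xs :: "real^'n" and \<theta>s :: "real^'m" and ls :: "real^'j"
    and \<theta> :: "nat \<Rightarrow> real^'m"
    and \<eta> :: "nat \<Rightarrow> real"
    and L\<^sub>H \<mu>\<^sub>H L\<^sub>d\<^sub>f L\<^sub>f\<^sub>x L\<^sub>f\<^sub>\<theta> L\<^sub>F\<^sub>x L\<^sub>F\<^sub>\<theta> L\<^sub>\<Phi> \<rho> C\<^sub>1 C\<^sub>2 :: real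
  assumes X_factors: "\<And>i. Xs i \<subseteq> range (block_part b i) \<and> Xs i \<noteq> {} \<and> closed (Xs i) \<and> convex (Xs i)"
    and X_product: "X = block_product b Xs"
    and F_cont: "continuous_on UNIV (\<lambda>(x, \<theta>). F x \<theta>)"
    and H_cont: "continuous_on UNIV H"
    and secondary_VI: "solves_VI \<Theta> H \<theta>s"
    and primary_VI: "solves_VI (feasible_set X f \<theta>s) (\<lambda>x. F x \<theta>s) xs"
    and F_mono: "\<And>\<theta>. \<theta> \<in> \<Theta> \<Longrightarrow>
          continuous_on X (\<lambda>x. F x \<theta>) \<and> monotone_map_on X (\<lambda>x. F x \<theta>)"
    and H_Lipschitz: "L\<^sub>H-lipschitz_on \<Theta> H"
    and H_strongly_mono: "strongly_monotone_map_on \<mu>\<^sub>H \<Theta> H"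
    and f_convex: "\<And>j \<theta>. \<theta> \<in> \<Theta> \<Longrightarrow> convex_on X (\<lambda>x. f x \<theta> $ j)"
    and f_C1: "\<And>j \<theta>. \<theta> \<in> \<Theta> \<Longrightarrow> (\<forall>x\<in>X. (\<lambda>z. f z \<theta> $ j) differentiable (at x)) \<and>
          continuous_on X (gradient (\<lambda>z. f z \<theta> $ j))"
    and f_grad_Lipschitz: "\<And>j \<theta>. \<theta> \<in> \<Theta> \<Longrightarrow>
          L\<^sub>d\<^sub>f-lipschitz_on X (gradient (\<lambda>z. f z \<theta> $ j))"
    and f_Lipschitz_x: "\<And>j \<theta>. \<theta> \<in> \<Theta> \<Longrightarrow> L\<^sub>f\<^sub>x-lipschitz_on X (\<lambda>x. f x \<theta> $ j)"
    and f_Lipschitz_\<theta>: "\<And>j x. x \<in> X \<Longrightarrow> L\<^sub>f\<^sub>\<theta>-lipschitz_on \<Theta> (\<lambda>\<theta>. f x \<theta> $ j)"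
    and F_Lipschitz_x: "\<And>\<theta>. \<theta> \<in> \<Theta> \<Longrightarrow> L\<^sub>F\<^sub>x-lipschitz_on X (\<lambda>x. F x \<theta>)"
    and F_Lipschitz_\<theta>: "\<And>x. x \<in> X \<Longrightarrow> L\<^sub>F\<^sub>\<theta>-lipschitz_on \<Theta> (\<lambda>\<theta>. F x \<theta>)"
    and X_set: "X \<noteq> {}" "closed X" "convex X" "compact X"
    and \<Theta>_set: "\<Theta> \<noteq> {}" "closed \<Theta>" "convex \<Theta>" "compact \<Theta>"
    and Slater: "\<exists>xhat\<in>X. \<forall>j. f xhat \<theta>s $ j < 0"
    and KKT: "KKT X \<Theta> F H f xs \<theta>s ls"
    and D_finite: "bdd_above ((\<lambda>(z, \<theta>). norm (pos_part (f z \<theta>))) ` (X \<times> \<Theta>))"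
    and M_finite: "bdd_above ((\<lambda>(z, \<theta>). onorm ((*v) (jacobian_x f z \<theta>))) ` (X \<times> \<Theta>))"
    and C1: "C\<^sub>1 = sqrt (real CARD('j)) *
          (L\<^sub>d\<^sub>f * constraint_bound X \<Theta> f + L\<^sub>f\<^sub>x * jacobian_bound X \<Theta> f)"
    and C2: "C\<^sub>2 = sqrt (real CARD('j)) * L\<^sub>d\<^sub>f"
    and L\<Phi>_pos: "L\<^sub>\<Phi> > 0"
    and L\<Phi>: "\<And>x l. x \<in> X \<Longrightarrow>
          L\<^sub>\<Phi>-lipschitz_on \<Theta> (\<lambda>\<theta>. gradient (\<lambda>l. Phi f \<rho> x l \<theta>) l)"
    and penalty: "\<rho> = 1 / L\<^sub>\<Phi>"
    and \<eta>_pos: "\<And>k. \<eta> k > 0"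
    and learning_summable: "summable (\<lambda>k. norm (\<theta> k - \<theta>s))"
    and learning_weighted_summable: "summable (\<lambda>k. (real k + 1)\<^sup>2 * (norm (\<theta> k - \<theta>s))\<^sup>2)"
(* D_Lambda is a constant of the problem and of the learning sequence, chosen before the step-size.
   The product form of the step-size bound reads the inverse of 0 as infinity. *)
  shows "\<exists>D\<^sub>\<Lambda>>0. \<forall>\<gamma>>0.
           \<gamma> * (\<rho> * C\<^sub>1 + norm ls * C\<^sub>2 + 2 * L\<^sub>F\<^sub>x + L\<^sub>F\<^sub>\<theta> + C\<^sub>2 * D\<^sub>\<Lambda>) < 1 \<longrightarrow>
           (\<forall>x l. ALM_iterates X \<Theta> F H f (\<lambda>_. \<rho>) (\<lambda>_. \<gamma>) \<eta> x \<theta> l \<longrightarrow> bounded (range l))"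
proof -
  interpret misspecified_problem X \<Theta> F H f xs \<theta>s ls L\<^sub>d\<^sub>f L\<^sub>f\<^sub>x L\<^sub>f\<^sub>\<theta> L\<^sub>F\<^sub>x L\<^sub>F\<^sub>\<theta>
    using assms by unfold_locales auto
  note [simp] = C1[folded C\<^sub>1_def] C2[folded C\<^sub>2_def]
  have "\<rho> > 0" using L\<Phi>_pos penalty by simp
  define S where "S = (\<Sum>k. norm (\<theta> k - \<theta>s))"
  let ?R = "diameter X" and ?J = "real CARD('j)"
  let ?A = "\<rho> * C\<^sub>1 + norm ls * C\<^sub>2 + 2 * L\<^sub>F\<^sub>x + L\<^sub>F\<^sub>\<theta>"
  \<comment> \<open>constant and linear part in \<open>D\<close> of the bound for \<open>\<parallel>\<lambda>\<^sub>k - \<lambda>\<^sup>*\<parallel>\<^sup>2\<close>\<close>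
  define E\<^sub>0 where "E\<^sub>0 = (norm ls)\<^sup>2 + 2 * \<rho> * ((L\<^sub>F\<^sub>x * ?R + L\<^sub>F\<^sub>\<theta> * diameter \<Theta>) * ?R
    + (L\<^sub>F\<^sub>\<theta> * ?R + ?J * (L\<^sub>f\<^sub>\<theta> * (2 * norm ls) + \<rho> / 2 * L\<^sub>f\<^sub>\<theta>\<^sup>2 * diameter \<Theta>)) * (4 * S))"
  define E\<^sub>1 where "E\<^sub>1 = 2 * \<rho> * (?J * L\<^sub>f\<^sub>\<theta> * (4 * S))"
  obtain D\<^sub>0 where "D\<^sub>0 > 0" and D\<^sub>0: "\<And>\<gamma>. \<gamma> > 0 \<Longrightarrow> \<gamma> * (?A + C\<^sub>2 * D\<^sub>0) < 1 \<Longrightarrow>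
      \<exists>D>0. \<gamma> * (?A + C\<^sub>2 * D) \<le> 1 \<and> E\<^sub>0 + E\<^sub>1 * D + \<rho> * ?R\<^sup>2 / \<gamma> \<le> D\<^sup>2"
    using exists_radius[of "\<rho> * ?R\<^sup>2" C\<^sub>2 ?A E\<^sub>0 E\<^sub>1] C2_nonneg \<open>\<rho> > 0\<close> C2[folded C\<^sub>2_def] by auto
  show ?thesis
  proof (intro exI[of _ D\<^sub>0] conjI allI impI)
    show "D\<^sub>0 > 0" by fact
    fix \<gamma> :: real and x l
    assume \<gamma>: "\<gamma> > 0" "\<gamma> * (?A + C\<^sub>2 * D\<^sub>0) < 1"
      and run: "ALM_iterates X \<Theta> F H f (\<lambda>_. \<rho>) (\<lambda>_. \<gamma>) \<eta> x \<theta> l"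
    interpret ALM_run X \<Theta> F H f xs \<theta>s ls L\<^sub>d\<^sub>f L\<^sub>f\<^sub>x L\<^sub>f\<^sub>\<theta> L\<^sub>F\<^sub>x L\<^sub>F\<^sub>\<theta> \<rho> \<gamma> \<eta> x \<theta> l
      using \<open>\<rho> > 0\<close> \<gamma>(1) run \<Theta>_set(2) by unfold_locales
    obtain D where D: "D > 0" "\<gamma> * (?A + C\<^sub>2 * D) \<le> 1" "E\<^sub>0 + E\<^sub>1 * D + \<rho> * ?R\<^sup>2 / \<gamma> \<le> D\<^sup>2"
      using D\<^sub>0[OF \<gamma>] by blast
    have "norm (l k - ls) \<le> D" for k
    proof (rule multiplier_distance_le[OF learning_summable])
      show "0 \<le> D" using D(1) by simp
      have "0 \<le> \<gamma> * L\<^sub>F\<^sub>\<theta>" using \<gamma>(1) Lipschitz_constants_nonneg by simp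
      then show "\<gamma> * (\<rho> * local.C\<^sub>1 + local.C\<^sub>2 * (norm ls + D) + 2 * L\<^sub>F\<^sub>x) \<le> 1"
        using D(2) by (simp add: algebra_simps)
      show "(norm ls)\<^sup>2 + \<rho> * ?R\<^sup>2 / \<gamma> + 2 * \<rho> * ((L\<^sub>F\<^sub>x * ?R + L\<^sub>F\<^sub>\<theta> * diameter \<Theta>) * ?R
          + (L\<^sub>F\<^sub>\<theta> * ?R + ?J * (L\<^sub>f\<^sub>\<theta> * (2 * norm ls + D) + \<rho> / 2 * L\<^sub>f\<^sub>\<theta>\<^sup>2 * diameter \<Theta>))
            * (4 * (\<Sum>k. norm (\<theta> k - \<theta>s)))) \<le> D\<^sup>2"
        using D(3) unfolding S_def[symmetric] E\<^sub>0_def E\<^sub>1_def by (simp add: algebra_simps)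
    qed
    then have "norm (l k) \<le> norm ls + D" for k
      using norm_triangle_ineq2[of "l k" ls] by (smt (verit))
    then show "bounded (range l)"
      by (auto simp: bounded_iff)
  qed
qed

end
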